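(* Let $y_0\in\Gamma(\mathcal{V}_0,Y)$ be a section and let $y\in\Gamma_S(\mathcal{V}_0,Y)$ be an admissible section with $y(v)=y_0(v)$ for all $v\in\operatorname{fr}\mathcal{V}$, and suppose that $y$ is regular. Then $y$ is critical with fixed boundary for the Lagrange problem with Lagrangian density $\mathcal{L}:J^1Y\to\mathbb{R}$ and constraint submanifold $S=\Phi^{-1}(e)\subset J^1Y$ if and only if there exists a mapping $\lambda\in\mathrm{Map}(\mathcal{V},\mathfrak{g}^* )$ such that for every $v\in\operatorname{int}\mathcal{V}$ $$\Big(\mathcal{E}_v(\mathcal{L})+\sum_{\alpha\in S_v}\pi_{v\alpha}^*\big(\lambda(\alpha)\circ\Theta_\alpha^v(\Phi)\big)\Big)_{(j^2y)(v)}=0 .$$ Moreover, this mapping $\lambda$ is unique.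
   Context: **Complex.** $V$ is an $n$-dimensional abstract cellular complex, $V_k$ its set of $k$-dimensional cells; elements of $V_0$ are vertices, elements of $V_n$ are faces. There is an incidence relation between $k$-cells and $(k+1)$-cells; a cell $\alpha$ is adherent to a cell $\beta$, written $\alpha\prec\beta$, if $\alpha=\beta$ or there is a chain of cells of consecutive dimensions from $\alpha$ to $\beta$, each incident to the next. Each face has finitely many adherent vertices. For $v\in V_0$, $S_v=\{\alpha\in V_n: v\prec\alpha\}$ (spherical neighborhood). $\mathcal{V}\subset V_n$ is a finite set of faces and $\mathcal{V}_0=\{v\in V_0: v\prec\alpha \text{ for some }\alpha\in\mathcal{V}\}$. A vertex $v\in\mathcal{V}_0$ is interior ($v\in\operatorname{int}\mathcal{V}$) if $S_v\subset\mathcal{V}$, and frontier ($v\in\operatorname{fr}\mathcal{V}$) otherwise. **Bundles.** $\pi:Y\to V_0$ is a bundle whose fibers $Y_v$ are differentiable manifolds of the same dimension $m$. $J^1Y=\bigsqcup_{\alpha\in V_n}(J^1Y)_\alpha$ with $(J^1Y)_\alpha=\prod_{v\prec\alpha}Y_v$. $(J^2Y)_v=\prod_{v'}Y_{v'}$, the product over all vertices $v'$ adherent to some face of $S_v$. For $\alpha\in S_v$, $\pi_{v\alpha}:(J^2Y)_v\to(J^1Y)_\alpha$ is the canonical projection. $\Gamma(\mathcal{V}_0,Y)=\prod_{v\in\mathcal{V}_0}Y_v$ is the manifold of sections over $\mathcal{V}_0$. For a section $y$, $(j^1y)(\alpha)=(y(v))_{v\prec\alpha}$ and $(j^2y)(v)=(y(v'))_{v'\prec\alpha\in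 S_v}$; for $\delta y\in T_y\Gamma(\mathcal{V}_0,Y)=\bigoplus_{v\in\mathcal V_0} T_{y(v)}Y_v$, $(j^1\delta y)(\alpha)=(\delta y(v))_{v\prec\alpha}$. **Lagrangian and constraint.** $\mathcal{L}:J^1Y\to\mathbb{R}$ is a family of smooth functions $\mathcal{L}_\alpha:(J^1Y)_\alpha\to\mathbb{R}$. $G$ is a Lie group with identity $e$, Lie algebra $\mathfrak{g}=T_eG$, and Maurer–Cartan form $\theta_g(D_g)=(L_{g^{-1}})_*D_g\in\mathfrak{g}$. $\Phi:J^1Y\to G$ is a map whose restrictions $\Phi_\alpha=\Phi|_{(J^1Y)_\alpha}$ are differentiable with $e$ a regular value; $S_\alpha=\Phi_\alpha^{-1}(e)$, $S=\bigsqcup_\alpha S_\alpha$. **Admissibility and criticality.** $y\in\Gamma(\mathcal{V}_0,Y)$ is admissible, $y\in\Gamma_S(\mathcal{V}_0,Y)$, if $(j^1y)(\alpha)\in S_\alpha$ for all $\alpha\in\mathcal{V}$. For $y$ admissible, $\delta y\in T_y\Gamma(\mathcal{V}_0,Y)$ is admissible if $(d\Phi_\alpha)_{(j^1y)(\alpha)}(j^1\delta y)(\alpha)=0$ for all $\alpha\in\mathcal{V}$. $T^c_y(\Gamma_S(\mathcal{V}_0,Y))$ is the space of admissible $\delta y$ vanishing at all $v\in\operatorname{fr}\mathcal{V}$. An admissible $y$ is critical with fixed boundary if the differential at $y$ of $\mathcal{A}_{\mathcal{V}}(\mathcal{L}):y\mapsto\sum_{\alpha\in\mathcal{V}}\mathcal{L}((j^1y)(\alpha))$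 vanishes on $T_y^c(\Gamma_S(\mathcal{V}_0,Y))$. **Regularity.** Let $\Gamma(\mathcal{V}_0,Y)(y_0(\operatorname{fr}\mathcal{V}))$ be the submanifold of sections equal to $y_0$ on $\operatorname{fr}\mathcal{V}$; its tangent space at $y$ consists of the $\delta y$ vanishing on $\operatorname{fr}\mathcal{V}$. Let $\Psi:\Gamma(\mathcal{V}_0,Y)\to\mathrm{Map}(\mathcal{V},G)$, $\Psi(y)(\alpha)=\Phi_\alpha((j^1y)(\alpha))$. The admissible section $y$ with boundary values $y_0(\operatorname{fr}\mathcal V)$ is regular if $(d\Psi)_y:T_y\big(\Gamma(\mathcal{V}_0,Y)(y_0(\operatorname{fr}\mathcal{V}))\big)\to\mathrm{Map}(\mathcal{V},\mathfrak{g})$, $\delta y\mapsto\big(\alpha\mapsto(\theta\circ d\Phi_\alpha)_{(j^1y)(\alpha)}((j^1\delta y)(\alpha))\big)$, is onto. **Cartan forms.** For $v\prec\alpha$, $\Theta_\alpha^v(\Phi)$ is the $\mathfrak{g}$-valued 1-form on $(J^1Y)_\alpha$ that is the component along $Y_v$ of $\theta\circ d\Phi_\alpha$: it sends $X=(X_{v'})_{v'\prec\alpha}$ to $(\theta\circ d\Phi_\alpha)$ applied to the vector with $v$-component $X_v$ and all other components $0$; thus $\theta\circ d\Phi_\alpha=\sum_{v\prec\alpha}\Theta_\alpha^v(\Phi)$. Likewise $\Theta^v_\alpha(\mathcal{L})$ is the component along $Y_v$ of $d\mathcal{L}_\alpha$. The Euler–Lagrange 1-form of $\mathcal{L}$ at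 $v$ is the 1-form $\mathcal{E}_v(\mathcal{L})=\sum_{\alpha\in S_v}\pi_{v\alpha}^*\Theta_\alpha^v(\mathcal{L})$ on $(J^2Y)_v$. In $\lambda(\alpha)\circ\Theta_\alpha^v(\Phi)$, $\circ$ is the duality pairing between $\mathfrak{g}^*$ and $\mathfrak{g}$. *)

theory Defs
  imports "HOL-Analysis.Analysis" "HOL-Algebra.Group" "HOL-Library.Function_Algebras"
begin

section \<open>Calculus on coordinate spaces with an arbitrary finite set of coordinates\<close>

text \<open>
  The manifolds \<open>(J\<^sup>1Y)\<^sub>\<alpha>\<close> and \<open>\<Gamma>(\<V>\<^sub>0,Y)\<close> are finite products whose number of factors depends on
  the face, respectively on the region, so the dimension cannot be tied to a type. Coordinate
  spaces are therefore indexed by sets: \<open>\<real>\<^sup>I\<close> consists of the functions that vanish off \<open>I\<close>, with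
  the pointwise operations.
\<close>

instantiation "fun" :: (type, real_vector) real_vector
begin

definition scaleR_fun_def: "r *\<^sub>R f = (\<lambda>x. r *\<^sub>R f x)"

instance
  by standard (auto simp: scaleR_fun_def fun_eq_iff scaleR_add_right scaleR_add_left)

end

definition fspace :: "'i set \<Rightarrow> ('i \<Rightarrow> real) set"
  where "fspace I = {x. \<forall>i. i \<notin> I \<longrightarrow> x i = 0}"

definition ftop :: "'i set \<Rightarrow> ('i \<Rightarrow> real) topology"
  where "ftop I = subtopology (powertop_real UNIV) (fspace I)"

text \<open>Frechet derivative of \<open>f : \<real>\<^sup>I \<rightarrow> \<real>\<^sup>K\<close> at \<open>x\<close>; \<open>D\<close> and \<open>f\<close> matter on \<open>\<real>\<^sup>I\<close> only.\<close>

definition has_fderiv ::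
    "'i set \<Rightarrow> 'k set \<Rightarrow> (('i \<Rightarrow> real) \<Rightarrow> ('k \<Rightarrow> real)) \<Rightarrow> (('i \<Rightarrow> real) \<Rightarrow> ('k \<Rightarrow> real))
      \<Rightarrow> ('i \<Rightarrow> real) \<Rightarrow> bool"
  where "has_fderiv I K f D x \<longleftrightarrow>
    linear D \<and> D ` fspace I \<subseteq> fspace K \<and>
    (\<forall>\<epsilon>>0. \<exists>\<delta>>0. \<forall>h\<in>fspace I. L2_set h I < \<delta> \<longrightarrow>
        L2_set (f (x + h) - f x - D h) K \<le> \<epsilon> * L2_set h I)"

definition fdifferentiable ::
    "'i set \<Rightarrow> 'k set \<Rightarrow> (('i \<Rightarrow> real) \<Rightarrow> ('k \<Rightarrow> real)) \<Rightarrow> ('i \<Rightarrow> real) \<Rightarrow> bool"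
  where "fdifferentiable I K f x \<longleftrightarrow> (\<exists>D. has_fderiv I K f D x)"

definition fderiv ::
    "'i set \<Rightarrow> 'k set \<Rightarrow> (('i \<Rightarrow> real) \<Rightarrow> ('k \<Rightarrow> real)) \<Rightarrow> ('i \<Rightarrow> real) \<Rightarrow> ('i \<Rightarrow> real) \<Rightarrow> ('k \<Rightarrow> real)"
  where "fderiv I K f x = (SOME D. has_fderiv I K f D x)"

text \<open>\<open>C\<^sup>k\<close> maps on an open \<open>U \<subseteq> \<real>\<^sup>I\<close>: \<open>f\<close> is \<open>C\<^sup>k\<^sup>+\<^sup>1\<close> iff it is Frechet differentiable and every
  directional derivative is \<open>C\<^sup>k\<close>.\<close>

primrec Ck_on ::
    "nat \<Rightarrow> 'i set \<Rightarrow> 'k set \<Rightarrow> ('i \<Rightarrow> real) set \<Rightarrow> (('i \<Rightarrow> real) \<Rightarrow> ('k \<Rightarrow> real)) \<Rightarrow> bool"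
  where
    "Ck_on 0 I K U f \<longleftrightarrow> continuous_map (subtopology (ftop I) U) (ftop K) f"
  | "Ck_on (Suc k) I K U f \<longleftrightarrow>
      (\<forall>x\<in>U. fdifferentiable I K f x) \<and>
      (\<forall>h\<in>fspace I. Ck_on k I K U (\<lambda>x. fderiv I K f x h))"

definition fsmooth_on ::
    "'i set \<Rightarrow> 'k set \<Rightarrow> ('i \<Rightarrow> real) set \<Rightarrow> (('i \<Rightarrow> real) \<Rightarrow> ('k \<Rightarrow> real)) \<Rightarrow> bool"
  where "fsmooth_on I K U f \<longleftrightarrow> (\<forall>k. Ck_on k I K U f)"


section \<open>Manifolds, tangent spaces, differentials\<close>

text \<open>A manifold is a topological space with an atlas, given as an indexed family of charts
  \<open>cmap M c\<close> on \<open>cdom M c\<close> with values in \<open>\<real>\<^sup>I\<close>, \<open>I = midx M\<close>; its dimension is \<open>card I\<close>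
  (zero is allowed).\<close>

record ('a, 'c, 'i) mfd =
  mtop :: "'a topology"
  midx :: "'i set"
  charts :: "'c set"
  cdom :: "'c \<Rightarrow> 'a set"
  cmap :: "'c \<Rightarrow> 'a \<Rightarrow> 'i \<Rightarrow> real"

abbreviation pts :: "('a, 'c, 'i) mfd \<Rightarrow> 'a set"
  where "pts M \<equiv> topspace (mtop M)"

abbreviation cinv :: "('a, 'c, 'i) mfd \<Rightarrow> 'c \<Rightarrow> ('i \<Rightarrow> real) \<Rightarrow> 'a"
  where "cinv M c \<equiv> inv_into (cdom M c) (cmap M c)"

definition charts_at :: "('a, 'c, 'i) mfd \<Rightarrow> 'a \<Rightarrow> 'c set"
  where "charts_at M p = {c \<in> charts M. p \<in> cdom M c}"

definition smooth_manifold :: "('a, 'c, 'i) mfd \<Rightarrow> bool"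
  where "smooth_manifold M \<longleftrightarrow>
    finite (midx M) \<and> Hausdorff_space (mtop M) \<and> second_countable (mtop M) \<and>
    (\<Union>c\<in>charts M. cdom M c) = pts M \<and>
    (\<forall>c\<in>charts M. openin (mtop M) (cdom M c) \<and>
        openin (ftop (midx M)) (cmap M c ` cdom M c) \<and>
        homeomorphic_map (subtopology (mtop M) (cdom M c))
          (subtopology (ftop (midx M)) (cmap M c ` cdom M c)) (cmap M c)) \<and>
    (\<forall>c\<in>charts M. \<forall>d\<in>charts M.
        fsmooth_on (midx M) (midx M) (cmap M c ` (cdom M c \<inter> cdom M d)) (cmap M d \<circ> cinv M c))"

definition smooth_map :: "('a, 'c, 'i) mfd \<Rightarrow> ('b, 'd, 'k) mfd \<Rightarrow> ('a \<Rightarrow> 'b) \<Rightarrow> bool"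
  where "smooth_map M N f \<longleftrightarrow>
    continuous_map (mtop M) (mtop N) f \<and>
    (\<forall>c\<in>charts M. \<forall>d\<in>charts N.
        fsmooth_on (midx M) (midx N) (cmap M c ` (cdom M c \<inter> f -` cdom N d))
          (cmap N d \<circ> f \<circ> cinv M c))"

definition differentiable_map :: "('a, 'c, 'i) mfd \<Rightarrow> ('b, 'd, 'k) mfd \<Rightarrow> ('a \<Rightarrow> 'b) \<Rightarrow> bool"
  where "differentiable_map M N f \<longleftrightarrow>
    continuous_map (mtop M) (mtop N) f \<and>
    (\<forall>p\<in>pts M. \<forall>c\<in>charts_at M p. \<forall>d\<in>charts_at N (f p).
        fdifferentiable (midx M) (midx N) (cmap N d \<circ> f \<circ> cinv M c) (cmap M c p))"

lemma smooth_map_imp_differentiable_map: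
  assumes "smooth_map M N f"
  shows "differentiable_map M N f"
proof -
  have "fdifferentiable (midx M) (midx N) (cmap N d \<circ> f \<circ> cinv M c) (cmap M c p)"
    if "c \<in> charts_at M p" "d \<in> charts_at N (f p)" for p c d
  proof -
    have "Ck_on (Suc 0) (midx M) (midx N) (cmap M c ` (cdom M c \<inter> f -` cdom N d))
          (cmap N d \<circ> f \<circ> cinv M c)"
      using assms that unfolding smooth_map_def fsmooth_on_def charts_at_def by blast
    with that show ?thesis
      by (auto simp: charts_at_def)
  qed
  with assms show ?thesis
    by (auto simp: smooth_map_def differentiable_map_def)
qed

text \<open>A tangent vector at \<open>p\<close> is a family of coordinate vectors, one for every chart around \<open>p\<close>,
  related by the derivatives of the chart transitions; the entries at the other charts are
  set to \<open>0\<close>, so that the vector space operations are the pointwise ones.\<close>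

type_synonym ('c, 'i) tvec = "'c \<Rightarrow> 'i \<Rightarrow> real"

definition tangent_space :: "('a, 'c, 'i) mfd \<Rightarrow> 'a \<Rightarrow> ('c, 'i) tvec set"
  where "tangent_space M p = {\<xi>.
    (\<forall>c\<in>charts_at M p. \<xi> c \<in> fspace (midx M)) \<and>
    (\<forall>c. c \<notin> charts_at M p \<longrightarrow> \<xi> c = 0) \<and>
    (\<forall>c\<in>charts_at M p. \<forall>d\<in>charts_at M p.
        \<xi> d = fderiv (midx M) (midx M) (cmap M d \<circ> cinv M c) (cmap M c p) (\<xi> c))}"

text \<open>The differential \<open>(df)\<^sub>p : T\<^sub>pM \<rightarrow> T\<^bsub>f(p)\<^esub>N\<close>, computed in an arbitrary chart around \<open>p\<close>.\<close>

definition tangent_map ::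
    "('a, 'c, 'i) mfd \<Rightarrow> ('b, 'd, 'k) mfd \<Rightarrow> ('a \<Rightarrow> 'b) \<Rightarrow> 'a \<Rightarrow> ('c, 'i) tvec \<Rightarrow> ('d, 'k) tvec"
  where "tangent_map M N f p \<xi> =
    (let c = (SOME c. c \<in> charts_at M p) in
      (\<lambda>d. if d \<in> charts_at N (f p)
           then fderiv (midx M) (midx N) (cmap N d \<circ> f \<circ> cinv M c) (cmap M c p) (\<xi> c) else 0))"

definition regular_value :: "('a, 'c, 'i) mfd \<Rightarrow> ('b, 'd, 'k) mfd \<Rightarrow> ('a \<Rightarrow> 'b) \<Rightarrow> 'b \<Rightarrow> bool"
  where "regular_value M N f q \<longleftrightarrow>
    (\<forall>p\<in>pts M. f p = q \<longrightarrow> tangent_map M N f p ` tangent_space M p = tangent_space N q)"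

definition real_line :: "(real, unit, unit) mfd"
  where "real_line =
    \<lparr>mtop = euclideanreal, midx = UNIV, charts = UNIV, cdom = (\<lambda>_. UNIV), cmap = (\<lambda>_ x _. x)\<rparr>"

text \<open>A chart of the product is a choice of one chart for every factor.\<close>

definition prod_mfd ::
    "'v set \<Rightarrow> ('v \<Rightarrow> ('a, 'c, 'i) mfd) \<Rightarrow> ('v \<Rightarrow> 'a, 'v \<Rightarrow> 'c, 'v \<times> 'i) mfd"
  where "prod_mfd A Y =
    \<lparr>mtop = product_topology (\<lambda>v. mtop (Y v)) A,
     midx = (SIGMA v:A. midx (Y v)),
     charts = (\<Pi>\<^sub>E v\<in>A. charts (Y v)),
     cdom = (\<lambda>c. \<Pi>\<^sub>E v\<in>A. cdom (Y v) (c v)),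
     cmap = (\<lambda>c y (v, i). if v \<in> A then cmap (Y v) (c v) (y v) i else 0)\<rparr>"

text \<open>The tangent space of a product in the form \<open>\<Oplus>\<^sub>v T\<^bsub>y(v)\<^esub>Y\<^sub>v\<close>: families of tangent vectors, with
  zero entries off \<open>A\<close>. The isomorphism onto \<open>tangent_space (prod_mfd A Y) y\<close> is
  \<open>prod_tvec A Y y\<close>.\<close>

type_synonym ('v, 'c, 'i) tfam = "'v \<Rightarrow> ('c, 'i) tvec"

definition prod_tangent_space ::
    "'v set \<Rightarrow> ('v \<Rightarrow> ('a, 'c, 'i) mfd) \<Rightarrow> ('v \<Rightarrow> 'a) \<Rightarrow> ('v, 'c, 'i) tfam set"
  where "prod_tangent_space A Y y =
    {X. (\<forall>v\<in>A. X v \<in> tangent_space (Y v) (y v)) \<and> (\<forall>v. v \<notin> A \<longrightarrow> X v = 0)}"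

definition prod_tvec ::
    "'v set \<Rightarrow> ('v \<Rightarrow> ('a, 'c, 'i) mfd) \<Rightarrow> ('v \<Rightarrow> 'a) \<Rightarrow> ('v, 'c, 'i) tfam \<Rightarrow> ('v \<Rightarrow> 'c, 'v \<times> 'i) tvec"
  where "prod_tvec A Y y X =
    (\<lambda>c. if c \<in> charts_at (prod_mfd A Y) y then (\<lambda>(v, i). X v (c v) i) else 0)"

definition prod_diff ::
    "'v set \<Rightarrow> ('v \<Rightarrow> ('a, 'c, 'i) mfd) \<Rightarrow> ('b, 'd, 'k) mfd \<Rightarrow> (('v \<Rightarrow> 'a) \<Rightarrow> 'b) \<Rightarrow> ('v \<Rightarrow> 'a)
      \<Rightarrow> ('v, 'c, 'i) tfam \<Rightarrow> ('d, 'k) tvec"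
  where "prod_diff A Y N F y X = tangent_map (prod_mfd A Y) N F y (prod_tvec A Y y X)"

text \<open>Differential of a real function on a product, where \<open>T\<^sub>x\<real> = \<real>\<close> via the unique chart (and the
  unique coordinate) of \<open>real_line\<close>.\<close>

definition prod_rdiff ::
    "'v set \<Rightarrow> ('v \<Rightarrow> ('a, 'c, 'i) mfd) \<Rightarrow> (('v \<Rightarrow> 'a) \<Rightarrow> real) \<Rightarrow> ('v \<Rightarrow> 'a) \<Rightarrow> ('v, 'c, 'i) tfam \<Rightarrow> real"
  where "prod_rdiff A Y F y X = prod_diff A Y real_line F y X () ()"


section \<open>Lie groups\<close>

text \<open>The manifold \<open>G \<times> G\<close> is the product indexed by \<^typ>\<open>bool\<close>.\<close>

definition lie_group :: "('g, 'd, 'k) mfd \<Rightarrow> 'g monoid \<Rightarrow> bool"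
  where "lie_group M G \<longleftrightarrow>
    smooth_manifold M \<and> group G \<and> carrier G = pts M \<and>
    smooth_map (prod_mfd (UNIV :: bool set) (\<lambda>_. M)) M (\<lambda>p. p False \<otimes>\<^bsub>G\<^esub> p True) \<and>
    smooth_map M M (\<lambda>g. inv\<^bsub>G\<^esub> g)"

definition lie_algebra :: "('g, 'd, 'k) mfd \<Rightarrow> 'g monoid \<Rightarrow> ('d, 'k) tvec set"
  where "lie_algebra M G = tangent_space M \<one>\<^bsub>G\<^esub>"

definition maurer_cartan ::
    "('g, 'd, 'k) mfd \<Rightarrow> 'g monoid \<Rightarrow> 'g \<Rightarrow> ('d, 'k) tvec \<Rightarrow> ('d, 'k) tvec"
  where "maurer_cartan M G g \<xi> = tangent_map M M (\<lambda>h. inv\<^bsub>G\<^esub> g \<otimes>\<^bsub>G\<^esub> h) g \<xi>"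

definition dual_space :: "'w::real_vector set \<Rightarrow> ('w \<Rightarrow> real) set"
  where "dual_space W = {l \<in> extensional W.
    (\<forall>x\<in>W. \<forall>y\<in>W. l (x + y) = l x + l y) \<and> (\<forall>r. \<forall>x\<in>W. l (r *\<^sub>R x) = r * l x)}"


section \<open>Cellular complexes\<close>

record 'x cell_complex =
  cells :: "nat \<Rightarrow> 'x set"
  incid :: "('x \<times> 'x) set"

definition cellular_complex :: "nat \<Rightarrow> 'x cell_complex \<Rightarrow> bool"
  where "cellular_complex n C \<longleftrightarrow>
    (\<forall>k>n. cells C k = {}) \<and>
    (\<forall>j k. j \<noteq> k \<longrightarrow> cells C j \<inter> cells C k = {}) \<and>
    incid C \<subseteq> (\<Union>k<n. cells C k \<times> cells C (Suc k))"

definition adherent :: "'x cell_complex \<Rightarrow> 'x \<Rightarrow> 'x \<Rightarrow> bool"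
  where "adherent C a b \<longleftrightarrow> (a, b) \<in> (incid C)\<^sup>*"

definition verts :: "'x cell_complex \<Rightarrow> 'x \<Rightarrow> 'x set"
  where "verts C a = {v \<in> cells C 0. adherent C v a}"

definition star :: "nat \<Rightarrow> 'x cell_complex \<Rightarrow> 'x \<Rightarrow> 'x set"
  where "star n C v = {a \<in> cells C n. adherent C v a}"

definition star_verts :: "nat \<Rightarrow> 'x cell_complex \<Rightarrow> 'x \<Rightarrow> 'x set"
  where "star_verts n C v = {v' \<in> cells C 0. \<exists>a\<in>star n C v. adherent C v' a}"

definition region_verts :: "'x cell_complex \<Rightarrow> 'x set \<Rightarrow> 'x set"
  where "region_verts C R = {v \<in> cells C 0. \<exists>a\<in>R. adherent C v a}"

definition interior_verts :: "nat \<Rightarrow> 'x cell_complex \<Rightarrow> 'x set \<Rightarrow> 'x set"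
  where "interior_verts n C R = {v \<in> region_verts C R. star n C v \<subseteq> R}"

definition frontier_verts :: "nat \<Rightarrow> 'x cell_complex \<Rightarrow> 'x set \<Rightarrow> 'x set"
  where "frontier_verts n C R = region_verts C R - interior_verts n C R"


section \<open>Jets and sections\<close>

text \<open>The bundle over the discrete set of vertices is the family \<open>Y\<close> of its fibers. A map on
  \<open>J\<^sup>1Y = \<Squnion>\<^sub>\<alpha> (J\<^sup>1Y)\<^sub>\<alpha>\<close> is a family of maps indexed by the faces.\<close>

abbreviation J1 :: "'x cell_complex \<Rightarrow> ('x \<Rightarrow> ('a, 'c, 'i) mfd) \<Rightarrow> 'x \<Rightarrow> ('x \<Rightarrow> 'a, 'x \<Rightarrow> 'c, 'x \<times> 'i) mfd"
  where "J1 C Y a \<equiv> prod_mfd (verts C a) Y"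

definition sections :: "'x cell_complex \<Rightarrow> ('x \<Rightarrow> ('a, 'c, 'i) mfd) \<Rightarrow> 'x set \<Rightarrow> ('x \<Rightarrow> 'a) set"
  where "sections C Y R = pts (prod_mfd (region_verts C R) Y)"

definition j1 :: "'x cell_complex \<Rightarrow> ('x \<Rightarrow> 'a) \<Rightarrow> 'x \<Rightarrow> ('x \<Rightarrow> 'a)"
  where "j1 C y a = restrict y (verts C a)"

definition j2 :: "nat \<Rightarrow> 'x cell_complex \<Rightarrow> ('x \<Rightarrow> 'a) \<Rightarrow> 'x \<Rightarrow> ('x \<Rightarrow> 'a)"
  where "j2 n C y v = restrict y (star_verts n C v)"

definition zrestrict :: "('v \<Rightarrow> 'w::zero) \<Rightarrow> 'v set \<Rightarrow> 'v \<Rightarrow> 'w"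
  where "zrestrict X A = (\<lambda>v. if v \<in> A then X v else 0)"

definition j1t :: "'x cell_complex \<Rightarrow> ('x, 'c, 'i) tfam \<Rightarrow> 'x \<Rightarrow> ('x, 'c, 'i) tfam"
  where "j1t C X a = zrestrict X (verts C a)"


section \<open>Admissible, critical and regular sections\<close>

definition admissible_sections ::
    "'x cell_complex \<Rightarrow> ('x \<Rightarrow> ('a, 'c, 'i) mfd) \<Rightarrow> 'g monoid \<Rightarrow> ('x \<Rightarrow> ('x \<Rightarrow> 'a) \<Rightarrow> 'g) \<Rightarrow> 'x set
      \<Rightarrow> ('x \<Rightarrow> 'a) set"
  where "admissible_sections C Y G \<Phi> R =
    {y \<in> sections C Y R. \<forall>a\<in>R. \<Phi> a (j1 C y a) = \<one>\<^bsub>G\<^esub>}"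

definition variations ::
    "'x cell_complex \<Rightarrow> ('x \<Rightarrow> ('a, 'c, 'i) mfd) \<Rightarrow> 'x set \<Rightarrow> ('x \<Rightarrow> 'a) \<Rightarrow> ('x, 'c, 'i) tfam set"
  where "variations C Y R y = prod_tangent_space (region_verts C R) Y y"

definition fixed_boundary_variations ::
    "nat \<Rightarrow> 'x cell_complex \<Rightarrow> ('x \<Rightarrow> ('a, 'c, 'i) mfd) \<Rightarrow> 'x set \<Rightarrow> ('x \<Rightarrow> 'a) \<Rightarrow> ('x, 'c, 'i) tfam set"
  where "fixed_boundary_variations n C Y R y =
    {X \<in> variations C Y R y. \<forall>v\<in>frontier_verts n C R. X v = 0}"

definition admissible_variations ::
    "'x cell_complex \<Rightarrow> ('x \<Rightarrow> ('a, 'c, 'i) mfd) \<Rightarrow> ('g, 'd, 'k) mfd \<Rightarrow> ('x \<Rightarrow> ('x \<Rightarrow> 'a) \<Rightarrow> 'g)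
      \<Rightarrow> 'x set \<Rightarrow> ('x \<Rightarrow> 'a) \<Rightarrow> ('x, 'c, 'i) tfam set"
  where "admissible_variations C Y M \<Phi> R y =
    {X \<in> variations C Y R y.
      \<forall>a\<in>R. prod_diff (verts C a) Y M (\<Phi> a) (j1 C y a) (j1t C X a) = 0}"

definition action :: "'x cell_complex \<Rightarrow> ('x \<Rightarrow> ('x \<Rightarrow> 'a) \<Rightarrow> real) \<Rightarrow> 'x set \<Rightarrow> ('x \<Rightarrow> 'a) \<Rightarrow> real"
  where "action C L R y = (\<Sum>a\<in>R. L a (j1 C y a))"

definition critical_fixed_boundary ::
    "nat \<Rightarrow> 'x cell_complex \<Rightarrow> ('x \<Rightarrow> ('a, 'c, 'i) mfd) \<Rightarrow> ('g, 'd, 'k) mfd \<Rightarrow> 'g monoid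
      \<Rightarrow> ('x \<Rightarrow> ('x \<Rightarrow> 'a) \<Rightarrow> 'g) \<Rightarrow> ('x \<Rightarrow> ('x \<Rightarrow> 'a) \<Rightarrow> real) \<Rightarrow> 'x set \<Rightarrow> ('x \<Rightarrow> 'a) \<Rightarrow> bool"
  where "critical_fixed_boundary n C Y M G \<Phi> L R y \<longleftrightarrow>
    y \<in> admissible_sections C Y G \<Phi> R \<and>
    (\<forall>X \<in> admissible_variations C Y M \<Phi> R y \<inter> fixed_boundary_variations n C Y R y.
        prod_rdiff (region_verts C R) Y (action C L R) y X = 0)"

definition theta_dPhi ::
    "'x cell_complex \<Rightarrow> ('x \<Rightarrow> ('a, 'c, 'i) mfd) \<Rightarrow> ('g, 'd, 'k) mfd \<Rightarrow> 'g monoid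
      \<Rightarrow> ('x \<Rightarrow> ('x \<Rightarrow> 'a) \<Rightarrow> 'g) \<Rightarrow> 'x \<Rightarrow> ('x \<Rightarrow> 'a) \<Rightarrow> ('x, 'c, 'i) tfam \<Rightarrow> ('d, 'k) tvec"
  where "theta_dPhi C Y M G \<Phi> a z X =
    maurer_cartan M G (\<Phi> a z) (prod_diff (verts C a) Y M (\<Phi> a) z X)"

definition regular_section ::
    "nat \<Rightarrow> 'x cell_complex \<Rightarrow> ('x \<Rightarrow> ('a, 'c, 'i) mfd) \<Rightarrow> ('g, 'd, 'k) mfd \<Rightarrow> 'g monoid
      \<Rightarrow> ('x \<Rightarrow> ('x \<Rightarrow> 'a) \<Rightarrow> 'g) \<Rightarrow> 'x set \<Rightarrow> ('x \<Rightarrow> 'a) \<Rightarrow> bool"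
  where "regular_section n C Y M G \<Phi> R y \<longleftrightarrow>
    (\<lambda>X. \<lambda>a\<in>R. theta_dPhi C Y M G \<Phi> a (j1 C y a) (j1t C X a)) ` fixed_boundary_variations n C Y R y
      = (R \<rightarrow>\<^sub>E lie_algebra M G)"


section \<open>Cartan forms and the Euler--Lagrange form\<close>

text \<open>A 1-form on a product manifold is a function of a point and of a family of tangent vectors.\<close>

definition form_component ::
    "'v \<Rightarrow> (('v \<Rightarrow> 'a) \<Rightarrow> ('v, 'c, 'i) tfam \<Rightarrow> 'w) \<Rightarrow> ('v \<Rightarrow> 'a) \<Rightarrow> ('v, 'c, 'i) tfam \<Rightarrow> 'w"
  where "form_component v \<omega> z X = \<omega> z ((\<lambda>_. 0)(v := X v))"

definition cartan_L ::
    "'x cell_complex \<Rightarrow> ('x \<Rightarrow> ('a, 'c, 'i) mfd) \<Rightarrow> ('x \<Rightarrow> ('x \<Rightarrow> 'a) \<Rightarrow> real) \<Rightarrow> 'x \<Rightarrow> 'x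
      \<Rightarrow> ('x \<Rightarrow> 'a) \<Rightarrow> ('x, 'c, 'i) tfam \<Rightarrow> real"
  where "cartan_L C Y L a v = form_component v (prod_rdiff (verts C a) Y (L a))"

definition cartan_Phi ::
    "'x cell_complex \<Rightarrow> ('x \<Rightarrow> ('a, 'c, 'i) mfd) \<Rightarrow> ('g, 'd, 'k) mfd \<Rightarrow> 'g monoid
      \<Rightarrow> ('x \<Rightarrow> ('x \<Rightarrow> 'a) \<Rightarrow> 'g) \<Rightarrow> 'x \<Rightarrow> 'x \<Rightarrow> ('x \<Rightarrow> 'a) \<Rightarrow> ('x, 'c, 'i) tfam \<Rightarrow> ('d, 'k) tvec"
  where "cartan_Phi C Y M G \<Phi> a v = form_component v (theta_dPhi C Y M G \<Phi> a)"

text \<open>Pullback along the canonical projection \<open>(J\<^sup>2Y)\<^sub>v \<rightarrow> (J\<^sup>1Y)\<^sub>\<alpha>\<close>, whose differential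
  restricts families of tangent vectors.\<close>

definition proj_pullback ::
    "'x cell_complex \<Rightarrow> 'x \<Rightarrow> (('x \<Rightarrow> 'a) \<Rightarrow> ('x, 'c, 'i) tfam \<Rightarrow> real)
      \<Rightarrow> ('x \<Rightarrow> 'a) \<Rightarrow> ('x, 'c, 'i) tfam \<Rightarrow> real"
  where "proj_pullback C a \<omega> z X = \<omega> (restrict z (verts C a)) (zrestrict X (verts C a))"

definition euler_lagrange_form ::
    "nat \<Rightarrow> 'x cell_complex \<Rightarrow> ('x \<Rightarrow> ('a, 'c, 'i) mfd) \<Rightarrow> ('x \<Rightarrow> ('x \<Rightarrow> 'a) \<Rightarrow> real) \<Rightarrow> 'x
      \<Rightarrow> ('x \<Rightarrow> 'a) \<Rightarrow> ('x, 'c, 'i) tfam \<Rightarrow> real"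
  where "euler_lagrange_form n C Y L v z X =
    (\<Sum>a\<in>star n C v. proj_pullback C a (cartan_L C Y L a v) z X)"

text \<open>A 1-form vanishes at a point of \<open>(J\<^sup>2Y)\<^sub>v\<close> iff it annihilates the
  whole tangent space there.\<close>

definition multiplier_equations ::
    "nat \<Rightarrow> 'x cell_complex \<Rightarrow> ('x \<Rightarrow> ('a, 'c, 'i) mfd) \<Rightarrow> ('g, 'd, 'k) mfd \<Rightarrow> 'g monoid
      \<Rightarrow> ('x \<Rightarrow> ('x \<Rightarrow> 'a) \<Rightarrow> 'g) \<Rightarrow> ('x \<Rightarrow> ('x \<Rightarrow> 'a) \<Rightarrow> real) \<Rightarrow> 'x set \<Rightarrow> ('x \<Rightarrow> 'a)
      \<Rightarrow> ('x \<Rightarrow> ('d, 'k) tvec \<Rightarrow> real) \<Rightarrow> bool"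
  where "multiplier_equations n C Y M G \<Phi> L R y l \<longleftrightarrow>
    (\<forall>v\<in>interior_verts n C R. \<forall>X\<in>prod_tangent_space (star_verts n C v) Y (j2 n C y v).
      euler_lagrange_form n C Y L v (j2 n C y v) X
      + (\<Sum>a\<in>star n C v. proj_pullback C a (\<lambda>z X. l a (cartan_Phi C Y M G \<Phi> a v z X)) (j2 n C y v) X)
      = 0)"

end

theory Submission
  imports Defs
begin

text \<open>
  The differential of the action splits into a sum over the faces, so a variation enters the
  multiplier equations only through its components at single interior vertices; since every
  variation vanishing on the frontier is the sum of its interior components, the equations at all
  interior vertices together say that \<open>dA + \<Sum>\<^sub>\<alpha> \<lambda>(\<alpha>) \<circ> d\<Phi>\<^sub>\<alpha> = 0\<close> on these variations. At an
  admissible section \<open>\<Phi>\<^sub>\<alpha>\<close> takes the value \<open>e\<close>, where the Maurer--Cartan form is the identity, so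
  regularity says that the constraint differentials map these variations onto \<open>Map(\<V>,\<gg>)\<close>. The
  claim is then the linear Lagrange multiplier theorem.
\<close>

section \<open>Frechet derivatives on coordinate spaces\<close>

text \<open>The linear algebra is short; most of the work is calculus. Coordinate spaces are indexed
  by sets, so derivatives are those of \<open>has_fderiv\<close>, and their uniqueness, locality and
  chain rule come first. Moreover \<open>fderiv\<close> is a choice among maps that are determined
  on \<open>fspace I\<close> only, and \<open>tangent_map\<close> evaluates it in a chart that is
  itself chosen. For the action this chart lives on the product over the whole region, for each
  \<open>L a\<close> on the product over one face, and the two choices are unrelated. Splitting the
  differential therefore means differentiating the restriction of sections to a face between two
  arbitrary product charts; the result is block diagonal and is absorbed by the compatibility
  condition that defines tangent vectors. The same condition settles the Maurer-Cartan form at the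
  identity. A second constraint: elements of \<open>dual_space\<close> are linear on the Lie algebra
  only and \<open>undefined\<close> outside it, so values of the constraint differential must be
  shown to lie in \<open>lie_algebra M G\<close> before linearity of a multiplier can be
  used.\<close>

lemma scaleR_fun_apply: "(r *\<^sub>R f) x = r *\<^sub>R f x"
  by (simp add: scaleR_fun_def)

text \<open>The filter of small increments turns the epsilon-delta clause of
  \<open>has_fderiv\<close> into an \<open>eventually\<close> statement: finitely many conditions
  can be intersected, and substitutions become \<open>filterlim\<close> facts. The balls are not
  punctured, so \<open>h = 0\<close> is always included.\<close>

definition fnhds0 :: "'i set \<Rightarrow> ('i \<Rightarrow> real) filter"
  where "fnhds0 I = (INF d\<in>{0<..}. principal {h \<in> fspace I. L2_set h I < d})"

lemma eventually_fnhds0: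
  "eventually P (fnhds0 I) \<longleftrightarrow> (\<exists>d>0. \<forall>h\<in>fspace I. L2_set h I < d \<longrightarrow> P h)"
proof -
  have "eventually P (fnhds0 I) \<longleftrightarrow>
      (\<exists>d\<in>{0<..}. eventually P (principal {h \<in> fspace I. L2_set h I < d}))"
    unfolding fnhds0_def
  proof (rule eventually_INF_base)
    fix a b :: real assume "a \<in> {0<..}" "b \<in> {0<..}"
    then show "\<exists>x\<in>{0<..}. principal {h \<in> fspace I. L2_set h I < x}
        \<le> inf (principal {h \<in> fspace I. L2_set h I < a}) (principal {h \<in> fspace I. L2_set h I < b})"
      by (intro bexI[of _ "min a b"]) auto
  qed auto
  then show ?thesis
    by (auto simp: eventually_principal)
qed

lemma eventually_fnhds0_fspace: "\<forall>\<^sub>F h in fnhds0 I. h \<in> fspace I"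
  by (auto simp: eventually_fnhds0 intro: exI[of _ 1])

lemma eventually_fnhds0_zero:
  assumes "eventually P (fnhds0 I)"
  shows "P 0"
  using assms by (auto simp: eventually_fnhds0 fspace_def L2_set_def)

lemma L2_set_abs: "L2_set (\<lambda>i. \<bar>f i\<bar>) I = L2_set f I"
  by (simp add: L2_set_def)

lemma abs_member_le_L2_set:
  assumes "finite I" "i \<in> I"
  shows "\<bar>f i\<bar> \<le> L2_set f I"
  using member_le_L2_set[OF assms, of "\<lambda>i. \<bar>f i\<bar>"] by (simp add: L2_set_abs)

lemma has_fderiv_iff:
  "has_fderiv I K f D x \<longleftrightarrow> linear D \<and> D ` fspace I \<subseteq> fspace K \<and>
    (\<forall>\<epsilon>>0. \<forall>\<^sub>F h in fnhds0 I. L2_set (f (x + h) - f x - D h) K \<le> \<epsilon> * L2_set h I)"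
  by (simp add: has_fderiv_def eventually_fnhds0)

text \<open>The L2 norm dominates each component and is dominated by the sum of their absolute
  values. This form suits products, where the component at \<open>(v, i)\<close> concerns the factor
  \<open>v\<close> alone.\<close>

lemma has_fderiv_iff_components:
  assumes "finite K"
  shows "has_fderiv I K f D x \<longleftrightarrow> linear D \<and> D ` fspace I \<subseteq> fspace K \<and>
    (\<forall>k\<in>K. \<forall>\<epsilon>>0. \<forall>\<^sub>F h in fnhds0 I. \<bar>f (x + h) k - f x k - D h k\<bar> \<le> \<epsilon> * L2_set h I)"
proof -
  have "(\<forall>\<epsilon>>0. \<forall>\<^sub>F h in fnhds0 I. L2_set (f (x + h) - f x - D h) K \<le> \<epsilon> * L2_set h I) \<longleftrightarrow>
    (\<forall>k\<in>K. \<forall>\<epsilon>>0. \<forall>\<^sub>F h in fnhds0 I. \<bar>f (x + h) k - f x k - D h k\<bar> \<le> \<epsilon> * L2_set h I)"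
    (is "?L \<longleftrightarrow> ?R")
  proof
    assume L: ?L
    show ?R
    proof (intro ballI allI impI)
      fix k \<epsilon> assume k: "k \<in> K" and "(0::real) < \<epsilon>"
      with L have "\<forall>\<^sub>F h in fnhds0 I. L2_set (f (x + h) - f x - D h) K \<le> \<epsilon> * L2_set h I"
        by blast
      then show "\<forall>\<^sub>F h in fnhds0 I. \<bar>f (x + h) k - f x k - D h k\<bar> \<le> \<epsilon> * L2_set h I"
      proof eventually_elim
        case (elim h)
        have "\<bar>f (x + h) k - f x k - D h k\<bar> \<le> L2_set (f (x + h) - f x - D h) K"
          using abs_member_le_L2_set[OF assms k, of "f (x + h) - f x - D h"] by simp
        with elim show ?case
          by simp
      qed
    qed
  next
    assume R: ?R
    show ?L
    proof (intro allI impI)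
      fix \<epsilon> :: real assume "0 < \<epsilon>"
      \<comment> \<open>An equal share of \<open>\<epsilon>\<close> for each component; the
        \<open>+ 1\<close> keeps the quotient meaningful in dimension zero.\<close>
      define e where "e = \<epsilon> / (card K + 1)"
      have "e > 0" and e: "card K * e \<le> \<epsilon>"
        using \<open>0 < \<epsilon>\<close> by (auto simp: e_def field_simps)
      have "\<forall>\<^sub>F h in fnhds0 I. \<forall>k\<in>K. \<bar>f (x + h) k - f x k - D h k\<bar> \<le> e * L2_set h I"
        using R \<open>e > 0\<close> by (intro eventually_ball_finite assms) auto
      then show "\<forall>\<^sub>F h in fnhds0 I. L2_set (f (x + h) - f x - D h) K \<le> \<epsilon> * L2_set h I"
      proof eventually_elim
        case (elim h)
        have "L2_set (f (x + h) - f x - D h) K \<le> (\<Sum>k\<in>K. \<bar>(f (x + h) - f x - D h) k\<bar>)"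
          by (rule L2_set_le_sum_abs)
        also have "\<dots> \<le> (\<Sum>k\<in>K. e * L2_set h I)"
          using elim by (intro sum_mono) auto
        also have "\<dots> = (card K * e) * L2_set h I"
          by simp
        also have "\<dots> \<le> \<epsilon> * L2_set h I"
          using e by (intro mult_right_mono L2_set_nonneg)
        finally show ?case .
      qed
    qed
  qed
  then show ?thesis
    by (simp add: has_fderiv_iff)
qed

text \<open>Locality of the derivative. Agreement at \<open>x\<close> itself is part of the
  assumption because \<open>h = 0\<close> belongs to the filter.\<close>

lemma has_fderiv_cong:
  assumes "\<forall>\<^sub>F h in fnhds0 I. f (x + h) = g (x + h)"
  shows "has_fderiv I K f D x \<longleftrightarrow> has_fderiv I K g D x"
proof -
  have 0: "f x = g x"
    using eventually_fnhds0_zero[OF assms] by simp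
  have "(\<forall>\<^sub>F h in fnhds0 I. L2_set (f (x + h) - f x - D h) K \<le> \<epsilon> * L2_set h I) \<longleftrightarrow>
      (\<forall>\<^sub>F h in fnhds0 I. L2_set (g (x + h) - g x - D h) K \<le> \<epsilon> * L2_set h I)" for \<epsilon>
    by (rule eventually_cong[OF assms]) (simp add: 0)
  then show ?thesis
    by (simp add: has_fderiv_iff)
qed

text \<open>The two predicates on \<open>D\<close> coincide, so \<open>SOME\<close> picks the same
  map whether or not a derivative exists.\<close>

lemma fderiv_cong:
  assumes "\<forall>\<^sub>F h in fnhds0 I. f (x + h) = g (x + h)"
  shows "fderiv I K f x = fderiv I K g x"
  by (simp add: fderiv_def has_fderiv_cong[OF assms])

lemma fdifferentiableD:
  "fdifferentiable I K f x \<Longrightarrow> has_fderiv I K f (fderiv I K f x) x"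
  unfolding fdifferentiable_def fderiv_def by (fact someI_ex)

lemma has_fderiv_linear: "has_fderiv I K f D x \<Longrightarrow> linear D"
  by (simp add: has_fderiv_def)

lemma has_fderiv_fspace: "has_fderiv I K f D x \<Longrightarrow> h \<in> fspace I \<Longrightarrow> D h \<in> fspace K"
  by (auto simp: has_fderiv_def)

lemma fspace_scaleR: "h \<in> fspace I \<Longrightarrow> t *\<^sub>R h \<in> fspace I"
  by (simp add: fspace_def scaleR_fun_apply)

lemma L2_set_scaleR: "L2_set (t *\<^sub>R h) I = \<bar>t\<bar> * L2_set h I"
  by (simp add: L2_set_def scaleR_fun_apply power_mult_distrib real_sqrt_mult flip: sum_distrib_left)

text \<open>Outside \<open>fspace I\<close> only linearity constrains \<open>D\<close>, so agreement
  is claimed for \<open>h\<close> in \<open>fspace I\<close>. There, small multiples of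
  \<open>h\<close> are tested: the difference and the error bound both scale with the multiple, so
  the bound holds for \<open>h\<close> itself.\<close>

lemma has_fderiv_unique:
  assumes D: "has_fderiv I K f D x" and E: "has_fderiv I K f E x" and h: "h \<in> fspace I"
    and K: "finite K"
  shows "D h = E h"
proof
  fix k
  show "D h k = E h k"
  proof (cases "k \<in> K")
    case False
    with has_fderiv_fspace[OF D h] has_fderiv_fspace[OF E h] show ?thesis
      by (simp add: fspace_def scaleR_fun_apply)
  next
    case True
    have bound: "\<bar>D h k - E h k\<bar> \<le> 2 * \<epsilon> * L2_set h I" if "\<epsilon> > 0" for \<epsilon>
    proof -
      have "\<forall>\<^sub>F h in fnhds0 I. \<bar>f (x + h) k - f x k - D h k\<bar> \<le> \<epsilon> * L2_set h I
          \<and> \<bar>f (x + h) k - f x k - E h k\<bar> \<le> \<epsilon> * L2_set h I"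
        using D E True that by (intro eventually_conj) (auto simp: has_fderiv_iff_components[OF K])
      then obtain d where d: "d > 0" "\<And>h. h \<in> fspace I \<Longrightarrow> L2_set h I < d \<Longrightarrow>
          \<bar>f (x + h) k - f x k - D h k\<bar> \<le> \<epsilon> * L2_set h I
          \<and> \<bar>f (x + h) k - f x k - E h k\<bar> \<le> \<epsilon> * L2_set h I"
        by (auto simp: eventually_fnhds0)
      \<comment> \<open>Small enough to bring the multiple of \<open>h\<close> into the ball of
        radius \<open>d\<close>; the \<open>+ 1\<close> covers an \<open>h\<close> of norm
        zero.\<close>
      define t where "t = d / (2 * (L2_set h I + 1))"
      have L: "L2_set h I \<ge> 0" by (rule L2_set_nonneg)
      have t: "t > 0" unfolding t_def using d(1) L by (intro divide_pos_pos mult_pos_pos) linarith+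
      have "2 * L2_set h I + 2 \<noteq> 0"
        using L by linarith
      then have "t * (L2_set h I + 1) = d / 2"
        by (simp add: t_def divide_simps)
      then have "t * L2_set h I < d"
        using t d(1) by (simp add: algebra_simps)
      then have "L2_set (t *\<^sub>R h) I < d"
        using t by (simp add: L2_set_scaleR)
      from d(2)[OF fspace_scaleR[OF h] this]
      have "\<bar>D (t *\<^sub>R h) k - E (t *\<^sub>R h) k\<bar> \<le> 2 * \<epsilon> * L2_set (t *\<^sub>R h) I"
        by linarith
      moreover have "D (t *\<^sub>R h) k - E (t *\<^sub>R h) k = t * (D h k - E h k)"
        by (simp add: linear_scale[OF has_fderiv_linear[OF D]] linear_scale[OF has_fderiv_linear[OF E]]
            scaleR_fun_apply right_diff_distrib)
      ultimately have "\<bar>t * (D h k - E h k)\<bar> \<le> 2 * \<epsilon> * (\<bar>t\<bar> * L2_set h I)"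
        by (simp only: L2_set_scaleR)
      then have "t * \<bar>D h k - E h k\<bar> \<le> t * (2 * \<epsilon> * L2_set h I)"
        using t by (simp only: abs_mult abs_of_pos ac_simps)
      then show ?thesis
        using t by simp
    qed
    have "\<bar>D h k - E h k\<bar> \<le> 0"
    proof (rule field_le_epsilon)
      fix e :: real assume "e > 0"
      define \<epsilon> where "\<epsilon> = e / (2 * (L2_set h I + 1))"
      have L: "L2_set h I \<ge> 0" by (rule L2_set_nonneg)
      have \<epsilon>: "\<epsilon> > 0"
        unfolding \<epsilon>_def using \<open>e > 0\<close> L by (intro divide_pos_pos mult_pos_pos) linarith+
      have "2 * L2_set h I + 2 \<noteq> 0"
        using L by linarith
      then have "2 * \<epsilon> * (L2_set h I + 1) = e"
        by (simp add: \<epsilon>_def divide_simps)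
      then have "2 * \<epsilon> * L2_set h I \<le> e"
        using \<epsilon> by (simp add: algebra_simps)
      with bound[OF \<epsilon>] show "\<bar>D h k - E h k\<bar> \<le> 0 + e" by linarith
    qed
    then show ?thesis by simp
  qed
qed

lemma fderiv_eqI:
  assumes "has_fderiv I K f D x" "h \<in> fspace I" "finite K"
  shows "fderiv I K f x h = D h"
  using assms fdifferentiableD fdifferentiable_def has_fderiv_unique by metis

lemma L2_set_add_le: "L2_set (f + g) K \<le> L2_set f K + L2_set g K"
  using L2_set_triangle_ineq[of f g K] by (simp add: plus_fun_def)

text \<open>\<open>B\<close> adds up the norms of the images of the coordinate vectors
  \<open>e i\<close>, and every coordinate of \<open>h\<close> is at most its norm. The estimate is
  proved for partial sums over any finite \<open>J\<close>; with \<open>J = I\<close> the sum is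
  \<open>h\<close>, because \<open>h\<close> vanishes off \<open>I\<close>.\<close>

lemma linear_L2_set_bounded:
  fixes D :: "('i \<Rightarrow> real) \<Rightarrow> ('k \<Rightarrow> real)"
  assumes "linear D" "finite I"
  obtains B where "B \<ge> 0" "\<And>h. h \<in> fspace I \<Longrightarrow> L2_set (D h) K \<le> B * L2_set h I"
proof
  define e :: "'i \<Rightarrow> 'i \<Rightarrow> real" where "e i j = (if j = i then 1 else 0)" for i j
  define B where "B = (\<Sum>i\<in>I. L2_set (D (e i)) K)"
  show "B \<ge> 0" by (simp add: B_def sum_nonneg L2_set_nonneg)
  fix h :: "'i \<Rightarrow> real" assume h: "h \<in> fspace I"
  have L: "L2_set (D (\<Sum>i\<in>J. h i *\<^sub>R e i)) K \<le> (\<Sum>i\<in>J. \<bar>h i\<bar> * L2_set (D (e i)) K)" if "finite J" for J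
    using that
  proof (induction J)
    case empty
    then show ?case using linear_0[OF assms(1)] by (simp add: L2_set_0' zero_fun_def)
  next
    case (insert j J)
    have "L2_set (D (\<Sum>i\<in>insert j J. h i *\<^sub>R e i)) K
        = L2_set (D (h j *\<^sub>R e j) + D (\<Sum>i\<in>J. h i *\<^sub>R e i)) K"
      by (simp only: sum.insert[OF insert.hyps] linear_add[OF assms(1)])
    also have "\<dots> \<le> L2_set (D (h j *\<^sub>R e j)) K + L2_set (D (\<Sum>i\<in>J. h i *\<^sub>R e i)) K"
      by (rule L2_set_add_le)
    also have "\<dots> \<le> \<bar>h j\<bar> * L2_set (D (e j)) K + (\<Sum>i\<in>J. \<bar>h i\<bar> * L2_set (D (e i)) K)"
      using insert.IH by (simp only: linear_scale[OF assms(1)] L2_set_scaleR insert.hyps add_le_cancel_left simp_thms)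
    finally show ?case
      by (simp only: sum.insert[OF insert.hyps])
  qed
  have "(\<Sum>i\<in>J. h i *\<^sub>R e i) j = (if j \<in> J then h j else 0)" if "finite J" for J j
    using that by (induction J) (auto simp: e_def scaleR_fun_apply)
  then have "(\<Sum>i\<in>I. h i *\<^sub>R e i) = h"
    using h assms(2) by (auto simp: fspace_def)
  with L[OF assms(2)] have "L2_set (D h) K \<le> (\<Sum>i\<in>I. \<bar>h i\<bar> * L2_set (D (e i)) K)"
    by simp
  also have "\<dots> \<le> (\<Sum>i\<in>I. L2_set h I * L2_set (D (e i)) K)"
    by (intro sum_mono mult_right_mono L2_set_nonneg abs_member_le_L2_set assms(2))
  also have "\<dots> = B * L2_set h I"
    by (simp add: B_def sum_distrib_left mult.commute)
  finally show "L2_set (D h) K \<le> B * L2_set h I" .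
qed

text \<open>The assumption \<open>into\<close> is there because the derivative of \<open>g\<close>
  is controlled along increments in \<open>fspace J\<close> only, while \<open>f\<close> is a total
  function whose values \<open>has_fderiv\<close> does not confine.\<close>

lemma has_fderiv_chain:
  assumes f: "has_fderiv I J f D x" and g: "has_fderiv J K g E (f x)"
    and I: "finite I" and J: "finite J"
    and into: "\<forall>\<^sub>F h in fnhds0 I. f (x + h) - f x \<in> fspace J"
  shows "has_fderiv I K (g \<circ> f) (E \<circ> D) x"
proof -
  have lin: "linear D" "linear E"
    using f g by (auto dest: has_fderiv_linear)
  obtain B where B: "B \<ge> 0" "\<And>h. h \<in> fspace I \<Longrightarrow> L2_set (D h) J \<le> B * L2_set h I"
    using linear_L2_set_bounded[OF lin(1) I] by blast
  obtain B' where B': "B' \<ge> 0" "\<And>h. h \<in> fspace J \<Longrightarrow> L2_set (E h) K \<le> B' * L2_set h J"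
    using linear_L2_set_bounded[OF lin(2) J] by blast
  have err: "\<forall>\<^sub>F h in fnhds0 I. L2_set (f (x + h) - f x - D h) J \<le> \<epsilon> * L2_set h I" if "\<epsilon> > 0" for \<epsilon>
    using f that by (auto simp: has_fderiv_iff)
  \<comment> \<open>The error estimate with tolerance 1 gives the Lipschitz constant
    \<open>1 + B\<close> at \<open>x\<close>.\<close>
  have size: "\<forall>\<^sub>F h in fnhds0 I. L2_set (f (x + h) - f x) J \<le> (1 + B) * L2_set h I"
    using err[OF zero_less_one] eventually_fnhds0_fspace
  proof eventually_elim
    case (elim h)
    have "f (x + h) - f x = (f (x + h) - f x - D h) + D h" by simp
    then have "L2_set (f (x + h) - f x) J \<le> L2_set (f (x + h) - f x - D h) J + L2_set (D h) J"
      using L2_set_add_le by metis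
    with elim B(2)[OF elim(2)] show ?case by (simp add: algebra_simps)
  qed
  have lim: "filterlim (\<lambda>h. f (x + h) - f x) (fnhds0 J) (fnhds0 I)"
  proof (unfold filterlim_iff, intro allI impI)
    fix P :: "('b \<Rightarrow> real) \<Rightarrow> bool" assume "eventually P (fnhds0 J)"
    then obtain d where d: "d > 0" "\<And>k. k \<in> fspace J \<Longrightarrow> L2_set k J < d \<Longrightarrow> P k"
      by (auto simp: eventually_fnhds0)
    have "\<forall>\<^sub>F h in fnhds0 I. L2_set h I < d / (1 + B)"
      unfolding eventually_fnhds0 using d(1) B(1) by (intro exI[of _ "d / (1 + B)"]) auto
    with size into show "\<forall>\<^sub>F h in fnhds0 I. P (f (x + h) - f x)"
    proof eventually_elim
      case (elim h)
      from elim(3) have "(1 + B) * L2_set h I < d"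
        using B(1) by (simp add: field_simps)
      with elim show ?case by (intro d) auto
    qed
  qed
  show ?thesis
    unfolding has_fderiv_iff
  proof (intro conjI allI impI)
    show "linear (E \<circ> D)" using lin by (rule linear_compose)
    show "(E \<circ> D) ` fspace I \<subseteq> fspace K"
      using has_fderiv_fspace[OF f] has_fderiv_fspace[OF g] by auto
    fix \<epsilon> :: real assume \<epsilon>: "\<epsilon> > 0"
    \<comment> \<open>The error splits into that of \<open>g\<close>, taken at an increment of norm
      at most \<open>(1 + B) * L2_set h I\<close>, and the image under \<open>E\<close> of the error
      of \<open>f\<close>. Each part gets half of \<open>\<epsilon>\<close>; \<open>1 + B'\<close>
      replaces \<open>B'\<close>, which may be zero.\<close>
    define e1 where "e1 = \<epsilon> / (2 * (1 + B))"
    define e2 where "e2 = \<epsilon> / (2 * (1 + B'))"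
    have e1: "e1 > 0" "e1 * (1 + B) = \<epsilon> / 2" and e2: "e2 > 0" "(1 + B') * e2 = \<epsilon> / 2"
      using \<epsilon> B(1) B'(1) by (simp_all add: e1_def e2_def divide_simps)
    have "\<forall>\<^sub>F k in fnhds0 J. L2_set (g (f x + k) - g (f x) - E k) K \<le> e1 * L2_set k J"
      using g e1 by (auto simp: has_fderiv_iff)
    then have "\<forall>\<^sub>F h in fnhds0 I. L2_set (g (f x + (f (x + h) - f x)) - g (f x) - E (f (x + h) - f x)) K
        \<le> e1 * L2_set (f (x + h) - f x) J"
      using lim unfolding filterlim_iff by blast
    with size into err[OF e2(1)] eventually_fnhds0_fspace[of I]
    show "\<forall>\<^sub>F h in fnhds0 I. L2_set ((g \<circ> f) (x + h) - (g \<circ> f) x - (E \<circ> D) h) K \<le> \<epsilon> * L2_set h I"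
    proof eventually_elim
      case (elim h)
      let ?k = "f (x + h) - f x"
      have "D h \<in> fspace J" using f elim(4) by (rule has_fderiv_fspace)
      with elim(2) have in_J: "?k - D h \<in> fspace J" by (simp add: fspace_def scaleR_fun_apply)
      have "(g \<circ> f) (x + h) - (g \<circ> f) x - (E \<circ> D) h = (g (f x + ?k) - g (f x) - E ?k) + E (?k - D h)"
        using lin by (simp add: linear_diff)
      then have "L2_set ((g \<circ> f) (x + h) - (g \<circ> f) x - (E \<circ> D) h) K
          \<le> L2_set (g (f x + ?k) - g (f x) - E ?k) K + L2_set (E (?k - D h)) K"
        using L2_set_add_le by metis
      also have "\<dots> \<le> e1 * ((1 + B) * L2_set h I) + (1 + B') * (e2 * L2_set h I)"
      proof (rule add_mono)
        show "L2_set (g (f x + ?k) - g (f x) - E ?k) K \<le> e1 * ((1 + B) * L2_set h I)"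
          using elim(5) mult_left_mono[OF elim(1), of e1] e1(1) by linarith
        have "L2_set (E (?k - D h)) K \<le> B' * L2_set (?k - D h) J"
          using in_J by (rule B')
        also have "\<dots> \<le> (1 + B') * (e2 * L2_set h I)"
          using elim(3) B'(1) L2_set_nonneg by (intro mult_mono) auto
        finally show "L2_set (E (?k - D h)) K \<le> (1 + B') * (e2 * L2_set h I)" .
      qed
      also have "\<dots> = \<epsilon> * L2_set h I"
      proof -
        have "e1 * ((1 + B) * L2_set h I) = \<epsilon> / 2 * L2_set h I"
          by (simp only: e1(2) flip: mult.assoc)
        moreover have "(1 + B') * (e2 * L2_set h I) = \<epsilon> / 2 * L2_set h I"
          by (simp only: e2(2) flip: mult.assoc)
        ultimately show ?thesis by linarith
      qed
      finally show ?case .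
    qed
  qed
qed

lemma has_fderiv_sum:
  fixes f :: "'a \<Rightarrow> ('i \<Rightarrow> real) \<Rightarrow> ('k \<Rightarrow> real)"
  assumes "finite A" "\<And>a. a \<in> A \<Longrightarrow> has_fderiv I K (f a) (D a) x"
  shows "has_fderiv I K (\<lambda>z. \<Sum>a\<in>A. f a z) (\<lambda>h. \<Sum>a\<in>A. D a h) x"
  using assms
proof (induction A)
  case empty
  have "linear (\<lambda>h::'i \<Rightarrow> real. 0::'k \<Rightarrow> real)"
    by (intro linearI) simp_all
  then show ?case
    by (auto simp: has_fderiv_iff fspace_def L2_set_0' zero_fun_def)
next
  case (insert b A)
  then have A: "has_fderiv I K (\<lambda>z. \<Sum>a\<in>A. f a z) (\<lambda>h. \<Sum>a\<in>A. D a h) x"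
    and b: "has_fderiv I K (f b) (D b) x"
    by auto
  have "has_fderiv I K (\<lambda>z. f b z + (\<Sum>a\<in>A. f a z)) (\<lambda>h. D b h + (\<Sum>a\<in>A. D a h)) x"
    (is "has_fderiv I K ?F ?D x")
    unfolding has_fderiv_iff
  proof (intro conjI allI impI)
    show "linear ?D"
      using A b by (intro linear_compose_add) (auto dest: has_fderiv_linear)
    show "?D ` fspace I \<subseteq> fspace K"
      using has_fderiv_fspace[OF A] has_fderiv_fspace[OF b] by (fastforce simp: fspace_def)
    fix \<epsilon> :: real assume "\<epsilon> > 0"
    then have "\<forall>\<^sub>F h in fnhds0 I. L2_set (f b (x + h) - f b x - D b h) K \<le> (\<epsilon> / 2) * L2_set h I"
      "\<forall>\<^sub>F h in fnhds0 I. L2_set ((\<Sum>a\<in>A. f a (x + h)) - (\<Sum>a\<in>A. f a x) - (\<Sum>a\<in>A. D a h)) K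
        \<le> (\<epsilon> / 2) * L2_set h I"
      using A b half_gt_zero unfolding has_fderiv_iff by blast+
    then show "\<forall>\<^sub>F h in fnhds0 I. L2_set (?F (x + h) - ?F x - ?D h) K \<le> \<epsilon> * L2_set h I"
    proof eventually_elim
      case (elim h)
      have "?F (x + h) - ?F x - ?D h = (f b (x + h) - f b x - D b h)
          + ((\<Sum>a\<in>A. f a (x + h)) - (\<Sum>a\<in>A. f a x) - (\<Sum>a\<in>A. D a h))"
        by (simp add: algebra_simps)
      then have "L2_set (?F (x + h) - ?F x - ?D h) K \<le> L2_set (f b (x + h) - f b x - D b h) K
          + L2_set ((\<Sum>a\<in>A. f a (x + h)) - (\<Sum>a\<in>A. f a x) - (\<Sum>a\<in>A. D a h)) K"
        using L2_set_add_le by metis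
      with elim show ?case by (simp add: algebra_simps)
    qed
  qed
  then show ?case
    by (simp only: sum.insert[OF insert.hyps])
qed

text \<open>Compares the product topology of \<open>ftop\<close> with the norm balls of
  \<open>fnhds0\<close>. A box around \<open>x\<close> may restrict every coordinate of the index
  type, but an increment moves only the finitely many in \<open>I\<close>, each by at most its
  norm.\<close>

lemma eventually_fnhds0_open:
  assumes "openin (ftop I) U" "x \<in> U" "finite I"
  shows "\<forall>\<^sub>F h in fnhds0 I. x + h \<in> U"
proof -
  from assms(1) obtain W where W: "openin (powertop_real UNIV) W" "U = W \<inter> fspace I"
    by (auto simp: ftop_def openin_subtopology)
  with assms(2) obtain V where V: "\<forall>i. open (V i)" "x \<in> PiE UNIV V" "PiE UNIV V \<subseteq> W"
    by (auto simp: openin_product_topology_alt)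
  have "\<exists>d>0. \<forall>t. \<bar>t\<bar> < d \<longrightarrow> x i + t \<in> V i" for i
  proof -
    have "open (V i)" "x i \<in> V i" using V by auto
    then obtain d where "d > 0" "\<And>u. dist u (x i) < d \<Longrightarrow> u \<in> V i"
      unfolding open_dist by blast
    then show ?thesis by (intro exI[of _ d]) (simp add: dist_norm)
  qed
  then obtain d where d: "\<And>i. d i > 0" "\<And>i t. \<bar>t\<bar> < d i \<Longrightarrow> x i + t \<in> V i"
    by metis
  have "\<forall>\<^sub>F h in fnhds0 I. L2_set h I < d i" for i
    using d(1)[of i] by (auto simp: eventually_fnhds0)
  then have "\<forall>\<^sub>F h in fnhds0 I. \<forall>i\<in>I. L2_set h I < d i"
    by (intro eventually_ball_finite assms(3)) auto
  with eventually_fnhds0_fspace show ?thesis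
  proof eventually_elim
    case (elim h)
    have "(x + h) i \<in> V i" for i
    proof (cases "i \<in> I")
      case True
      have "\<bar>h i\<bar> \<le> L2_set h I"
        using assms(3) True by (rule abs_member_le_L2_set)
      with elim(2) True have "\<bar>h i\<bar> < d i" by fastforce
      then show ?thesis using d(2) by simp
    next
      case False
      with elim(1) have "h i = 0" by (simp add: fspace_def scaleR_fun_apply)
      with V(2) show ?thesis by auto
    qed
    then have "x + h \<in> W" using V(3) by auto
    moreover have "x + h \<in> fspace I"
      using elim(1) assms(2) W(2) by (auto simp: fspace_def)
    ultimately show ?case using W(2) by simp
  qed
qed

section \<open>Products of manifolds\<close>

lemma L2_set_slice_le:
  assumes "finite (Sigma B I)" "v \<in> B"
  shows "L2_set (\<lambda>i. h (v, i)) (I v) \<le> L2_set h (Sigma B I)"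
proof -
  have "(\<Sum>i\<in>I v. (h (v, i))\<^sup>2) = (\<Sum>p\<in>Pair v ` I v. (h p)\<^sup>2)"
    by (subst sum.reindex) (auto simp: inj_on_def)
  also have "\<dots> \<le> (\<Sum>p\<in>Sigma B I. (h p)\<^sup>2)"
    using assms by (intro sum_mono2) auto
  finally show ?thesis by (simp add: L2_set_def)
qed

text \<open>The coordinates of one factor are a slice of those of the product, of no larger norm;
  estimates in a factor can thus be pulled back to the product.\<close>

lemma filterlim_slice:
  fixes I :: "'v \<Rightarrow> 'i set"
  assumes "finite (Sigma B I)" "v \<in> B"
  shows "filterlim (\<lambda>h i. h (v, i)) (fnhds0 (I v)) (fnhds0 (Sigma B I))"
  unfolding filterlim_iff
proof (intro allI impI)
  fix P :: "('i \<Rightarrow> real) \<Rightarrow> bool" assume "eventually P (fnhds0 (I v))"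
  then obtain d where d: "d > 0" "\<And>h. h \<in> fspace (I v) \<Longrightarrow> L2_set h (I v) < d \<Longrightarrow> P h"
    by (auto simp: eventually_fnhds0)
  have "P (\<lambda>i. h (v, i))" if "h \<in> fspace (Sigma B I)" "L2_set h (Sigma B I) < d" for h
    using that L2_set_slice_le[OF assms, of h] by (intro d) (auto simp: fspace_def)
  with d(1) show "\<forall>\<^sub>F h in fnhds0 (Sigma B I). P (\<lambda>i. h (v, i))"
    by (auto simp: eventually_fnhds0)
qed

section \<open>Charts and tangent spaces of a single manifold\<close>

lemma chart_homeomorphic:
  assumes "smooth_manifold M" "c \<in> charts M"
  shows "homeomorphic_map (subtopology (mtop M) (cdom M c))
          (subtopology (ftop (midx M)) (cmap M c ` cdom M c)) (cmap M c)"
    and "openin (mtop M) (cdom M c)" and "openin (ftop (midx M)) (cmap M c ` cdom M c)"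
  using assms by (auto simp: smooth_manifold_def)

lemma chart_inj_on:
  assumes "smooth_manifold M" "c \<in> charts M"
  shows "inj_on (cmap M c) (cdom M c)"
  using homeomorphic_imp_injective_map[OF chart_homeomorphic(1)[OF assms]]
    openin_subset[OF chart_homeomorphic(2)[OF assms]]
  by (simp add: Int_absorb1)

lemma chart_in_fspace:
  assumes "smooth_manifold M" "c \<in> charts M" "p \<in> cdom M c"
  shows "cmap M c p \<in> fspace (midx M)"
  using openin_subset[OF chart_homeomorphic(3)[OF assms(1,2)]] assms(3) by (auto simp: ftop_def)

lemma charts_at_nonempty:
  assumes "smooth_manifold M" "p \<in> pts M"
  shows "\<exists>c. c \<in> charts_at M p"
  using assms by (auto simp: smooth_manifold_def charts_at_def)

lemma finite_midx: "smooth_manifold M \<Longrightarrow> finite (midx M)"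
  by (simp add: smooth_manifold_def)

text \<open>The chart is a homeomorphism onto an open set, so it maps the open overlap to an open
  subset of the coordinate space. Hence identities between maps read in charts need checking on
  overlaps only.\<close>

lemma eventually_in_chart_overlap:
  assumes M: "smooth_manifold M" and c: "c \<in> charts_at M p" and d: "d \<in> charts_at M p"
  shows "\<forall>\<^sub>F h in fnhds0 (midx M). cmap M c p + h \<in> cmap M c ` (cdom M c \<inter> cdom M d)"
proof (rule eventually_fnhds0_open)
  have ch: "c \<in> charts M" "d \<in> charts M"
    using c d by (auto simp: charts_at_def)
  have "openin (subtopology (mtop M) (cdom M c)) (cdom M c \<inter> cdom M d)"
    using chart_homeomorphic(2)[OF M ch(2)] by (auto simp: openin_subtopology)
  then have "openin (subtopology (ftop (midx M)) (cmap M c ` cdom M c)) (cmap M c ` (cdom M c \<inter> cdom M d))"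
    using homeomorphic_imp_open_map[OF chart_homeomorphic(1)[OF M ch(1)]] by (auto simp: open_map_def)
  then show "openin (ftop (midx M)) (cmap M c ` (cdom M c \<inter> cdom M d))"
    using chart_homeomorphic(3)[OF M ch(1)] by (rule openin_trans_full)
  show "cmap M c p \<in> cmap M c ` (cdom M c \<inter> cdom M d)"
    using c d by (auto simp: charts_at_def)
qed (rule finite_midx[OF M])

abbreviation dtrans :: "('a, 'c, 'i) mfd \<Rightarrow> 'a \<Rightarrow> 'c \<Rightarrow> 'c \<Rightarrow> ('i \<Rightarrow> real) \<Rightarrow> ('i \<Rightarrow> real)"
  where "dtrans M p c d \<equiv> fderiv (midx M) (midx M) (cmap M d \<circ> cinv M c) (cmap M c p)"

lemma has_fderiv_transition:
  assumes M: "smooth_manifold M" and c: "c \<in> charts_at M p" and d: "d \<in> charts_at M p"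
  shows "has_fderiv (midx M) (midx M) (cmap M d \<circ> cinv M c) (dtrans M p c d) (cmap M c p)"
proof (rule fdifferentiableD)
  have "c \<in> charts M" "d \<in> charts M"
    using c d by (auto simp: charts_at_def)
  then have "fsmooth_on (midx M) (midx M) (cmap M c ` (cdom M c \<inter> cdom M d)) (cmap M d \<circ> cinv M c)"
    using M unfolding smooth_manifold_def by blast
  then have "Ck_on (Suc 0) (midx M) (midx M) (cmap M c ` (cdom M c \<inter> cdom M d)) (cmap M d \<circ> cinv M c)"
    unfolding fsmooth_on_def by blast
  then show "fdifferentiable (midx M) (midx M) (cmap M d \<circ> cinv M c) (cmap M c p)"
    using c d by (auto simp: charts_at_def)
qed

lemma linear_dtrans:
  assumes "smooth_manifold M" "c \<in> charts_at M p" "d \<in> charts_at M p"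
  shows "linear (dtrans M p c d)"
  using has_fderiv_linear[OF has_fderiv_transition[OF assms]] .

lemma tangent_spaceD:
  assumes "\<xi> \<in> tangent_space M p"
  shows tangent_space_in_fspace: "c \<in> charts_at M p \<Longrightarrow> \<xi> c \<in> fspace (midx M)"
    and tangent_space_off_charts: "c \<notin> charts_at M p \<Longrightarrow> \<xi> c = 0"
    and dtrans_tangent_space: "c \<in> charts_at M p \<Longrightarrow> d \<in> charts_at M p \<Longrightarrow> dtrans M p c d (\<xi> c) = \<xi> d"
proof -
  have "(\<forall>c\<in>charts_at M p. \<xi> c \<in> fspace (midx M)) \<and> (\<forall>c. c \<notin> charts_at M p \<longrightarrow> \<xi> c = 0) \<and>
      (\<forall>c\<in>charts_at M p. \<forall>d\<in>charts_at M p. \<xi> d = dtrans M p c d (\<xi> c))"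
    using assms unfolding tangent_space_def by (rule CollectD)
  note * = this[THEN conjunct1] this[THEN conjunct2, THEN conjunct1] this[THEN conjunct2, THEN conjunct2]
  show "c \<in> charts_at M p \<Longrightarrow> \<xi> c \<in> fspace (midx M)"
    using *(1) by (rule bspec)
  show "c \<notin> charts_at M p \<Longrightarrow> \<xi> c = 0"
    using *(2)[rule_format, of c] .
  show "c \<in> charts_at M p \<Longrightarrow> d \<in> charts_at M p \<Longrightarrow> dtrans M p c d (\<xi> c) = \<xi> d"
    using *(3)[THEN bspec, THEN bspec, of c d] by (rule sym)
qed

lemma tangent_spaceI:
  assumes "\<And>c. c \<in> charts_at M p \<Longrightarrow> \<xi> c \<in> fspace (midx M)"
    and "\<And>c. c \<notin> charts_at M p \<Longrightarrow> \<xi> c = 0"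
    and "\<And>c d. c \<in> charts_at M p \<Longrightarrow> d \<in> charts_at M p \<Longrightarrow> dtrans M p c d (\<xi> c) = \<xi> d"
  shows "\<xi> \<in> tangent_space M p"
  unfolding tangent_space_def by (intro CollectI conjI ballI allI impI assms(1,2) assms(3)[symmetric])

lemma tangent_space_subspace:
  assumes M: "smooth_manifold M"
  shows "subspace (tangent_space M p)"
proof (rule subspaceI)
  show "0 \<in> tangent_space M p"
    using linear_0[OF linear_dtrans[OF M]] by (intro tangent_spaceI) (auto simp: fspace_def)
  show "\<xi> + \<eta> \<in> tangent_space M p" if "\<xi> \<in> tangent_space M p" "\<eta> \<in> tangent_space M p" for \<xi> \<eta>
  proof (rule tangent_spaceI)
    show "dtrans M p c d ((\<xi> + \<eta>) c) = (\<xi> + \<eta>) d" if "c \<in> charts_at M p" "d \<in> charts_at M p" for c d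
      by (simp only: plus_fun_apply[of \<xi>] linear_add[OF linear_dtrans[OF M that]]
          dtrans_tangent_space[OF \<open>\<xi> \<in> _\<close> that] dtrans_tangent_space[OF \<open>\<eta> \<in> _\<close> that])
  qed (use tangent_spaceD(1,2)[OF that(1)] tangent_spaceD(1,2)[OF that(2)] in \<open>auto simp: fspace_def\<close>)
  show "r *\<^sub>R \<xi> \<in> tangent_space M p" if "\<xi> \<in> tangent_space M p" for r \<xi>
  proof (rule tangent_spaceI)
    show "dtrans M p c d ((r *\<^sub>R \<xi>) c) = (r *\<^sub>R \<xi>) d" if "c \<in> charts_at M p" "d \<in> charts_at M p" for c d
      by (simp only: scaleR_fun_apply[of r \<xi>] linear_scale[OF linear_dtrans[OF M that]]
          dtrans_tangent_space[OF \<open>\<xi> \<in> _\<close> that])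
  qed (use tangent_spaceD(1,2)[OF that] in \<open>auto simp: fspace_def scaleR_fun_apply\<close>)
qed

section \<open>Charts of a product manifold\<close>

lemma prod_mfd_simps [simp]:
  "mtop (prod_mfd A Y) = product_topology (\<lambda>v. mtop (Y v)) A"
  "midx (prod_mfd A Y) = (SIGMA v:A. midx (Y v))"
  "charts (prod_mfd A Y) = (\<Pi>\<^sub>E v\<in>A. charts (Y v))"
  "cdom (prod_mfd A Y) c = (\<Pi>\<^sub>E v\<in>A. cdom (Y v) (c v))"
  "cmap (prod_mfd A Y) c y (v, i) = (if v \<in> A then cmap (Y v) (c v) (y v) i else 0)"
  by (simp_all add: prod_mfd_def)

lemma charts_at_prod:
  "c \<in> charts_at (prod_mfd A Y) y \<longleftrightarrow>
    c \<in> extensional A \<and> y \<in> extensional A \<and> (\<forall>v\<in>A. c v \<in> charts_at (Y v) (y v))"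
  by (auto simp: charts_at_def PiE_iff)

context
  fixes B :: "'v set" and Y :: "'v \<Rightarrow> ('a, 'c, 'i) mfd"
  assumes fin: "finite B" and mfd: "\<forall>v\<in>B. smooth_manifold (Y v)"
begin

lemma finite_midx_prod: "finite (midx (prod_mfd B Y))"
  using fin mfd finite_midx by auto

lemma charts_at_prod_nonempty:
  assumes "y \<in> pts (prod_mfd B Y)"
  shows "\<exists>c. c \<in> charts_at (prod_mfd B Y) y"
proof -
  have "\<forall>v\<in>B. \<exists>c. c \<in> charts_at (Y v) (y v)"
    using assms mfd charts_at_nonempty by (fastforce simp: PiE_iff)
  then obtain c where "\<forall>v\<in>B. c v \<in> charts_at (Y v) (y v)"
    by metis
  with assms have "restrict c B \<in> charts_at (prod_mfd B Y) y"
    by (auto simp: charts_at_prod PiE_iff)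
  then show ?thesis by blast
qed

lemma prod_chart_inj_on:
  assumes "c \<in> charts (prod_mfd B Y)"
  shows "inj_on (cmap (prod_mfd B Y) c) (cdom (prod_mfd B Y) c)"
proof (rule inj_onI)
  fix y z assume yz: "y \<in> cdom (prod_mfd B Y) c" "z \<in> cdom (prod_mfd B Y) c"
    and eq: "cmap (prod_mfd B Y) c y = cmap (prod_mfd B Y) c z"
  have "y v = z v" if v: "v \<in> B" for v
  proof -
    have "cmap (Y v) (c v) (y v) = cmap (Y v) (c v) (z v)"
    proof
      fix i show "cmap (Y v) (c v) (y v) i = cmap (Y v) (c v) (z v) i"
        using fun_cong[OF eq, of "(v, i)"] v by simp
    qed
    moreover have "inj_on (cmap (Y v) (c v)) (cdom (Y v) (c v))"
      using assms v by (intro chart_inj_on mfd[rule_format]) auto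
    ultimately show ?thesis
      using yz v by (auto simp: PiE_iff dest: inj_onD)
  qed
  with yz show "y = z"
    by (auto intro: PiE_ext)
qed

lemma prod_chart_in_fspace:
  assumes "c \<in> charts (prod_mfd B Y)" "y \<in> cdom (prod_mfd B Y) c"
  shows "cmap (prod_mfd B Y) c y \<in> fspace (midx (prod_mfd B Y))"
proof -
  have "cmap (Y v) (c v) (y v) \<in> fspace (midx (Y v))" if "v \<in> B" for v
    using assms that by (intro chart_in_fspace mfd[rule_format]) (auto simp: PiE_iff)
  then show ?thesis by (auto simp: fspace_def)
qed

text \<open>\<open>cinv\<close> of the product inverts one map on the whole chart domain;
  injectivity identifies its value with the tuple of factorwise preimages. The condition off
  \<open>B\<close> is needed since product charts are zero there.\<close>

lemma prod_cinv_eq: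
  assumes c: "c \<in> charts (prod_mfd B Y)"
    and w: "\<forall>v\<in>B. (\<lambda>i. w (v, i)) \<in> cmap (Y v) (c v) ` cdom (Y v) (c v)"
    and off: "\<forall>v. v \<notin> B \<longrightarrow> (\<forall>i. w (v, i) = 0)"
  defines "z \<equiv> \<lambda>v\<in>B. cinv (Y v) (c v) (\<lambda>i. w (v, i))"
  shows "z \<in> cdom (prod_mfd B Y) c" and "cmap (prod_mfd B Y) c z = w"
    and "cinv (prod_mfd B Y) c w = z"
proof -
  show z: "z \<in> cdom (prod_mfd B Y) c"
    using w by (auto simp: z_def intro: inv_into_into)
  have "cmap (prod_mfd B Y) c z (v, i) = w (v, i)" for v i
    using w off by (cases "v \<in> B") (auto simp: z_def f_inv_into_f)
  then show "cmap (prod_mfd B Y) c z = w" by auto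
  with z show "cinv (prod_mfd B Y) c w = z"
    using prod_chart_inj_on[OF c] by (auto intro: inv_into_f_eq)
qed

end

text \<open>Block-diagonal candidate for the derivative of restriction to \<open>A\<close> followed
  by reading in a chart \<open>d\<close> of the smaller product, starting from a chart
  \<open>c\<close> of a larger one. With equal index sets it is the derivative of an ordinary chart
  change.\<close>

definition prod_dtrans ::
    "'v set \<Rightarrow> ('v \<Rightarrow> ('a, 'c, 'i) mfd) \<Rightarrow> ('v \<Rightarrow> 'a) \<Rightarrow> ('v \<Rightarrow> 'c) \<Rightarrow> ('v \<Rightarrow> 'c)
      \<Rightarrow> ('v \<times> 'i \<Rightarrow> real) \<Rightarrow> ('v \<times> 'i \<Rightarrow> real)"
  where "prod_dtrans A Y y c d h =
    (\<lambda>(v, i). if v \<in> A then dtrans (Y v) (y v) (c v) (d v) (\<lambda>i. h (v, i)) i else 0)"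

context
  fixes A B :: "'v set" and Y :: "'v \<Rightarrow> ('a, 'c, 'i) mfd" and y c d
  assumes fin: "finite B" and mfd: "\<forall>v\<in>B. smooth_manifold (Y v)" and AB: "A \<subseteq> B"
    and c: "c \<in> charts_at (prod_mfd B Y) y" and d: "d \<in> charts_at (prod_mfd A Y) (restrict y A)"
begin

lemma charts_at_factor:
  shows "v \<in> B \<Longrightarrow> c v \<in> charts_at (Y v) (y v)" and "v \<in> A \<Longrightarrow> d v \<in> charts_at (Y v) (y v)"
  using c d by (auto simp: charts_at_prod)

lemma in_cdom_prod: "y \<in> cdom (prod_mfd B Y) c" "restrict y A \<in> cdom (prod_mfd A Y) d"
  and in_charts_prod: "c \<in> charts (prod_mfd B Y)" "d \<in> charts (prod_mfd A Y)"
  using c d unfolding charts_at_def by auto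

text \<open>Overlaps are open in each factor, and finiteness of \<open>B\<close> allows these
  conditions to be intersected. Near the base point the inverse of the product chart thus becomes
  explicit, which is all that locality of the derivative requires.\<close>

lemma eventually_prod_transition:
  "\<forall>\<^sub>F h in fnhds0 (midx (prod_mfd B Y)).
     cmap (prod_mfd B Y) c y + h \<in> cmap (prod_mfd B Y) c ` cdom (prod_mfd B Y) c \<and>
     restrict (cinv (prod_mfd B Y) c (cmap (prod_mfd B Y) c y + h)) A \<in> cdom (prod_mfd A Y) d \<and>
     (\<forall>v\<in>A. cinv (prod_mfd B Y) c (cmap (prod_mfd B Y) c y + h) v
        = cinv (Y v) (c v) (cmap (Y v) (c v) (y v) + (\<lambda>i. h (v, i))))"
proof -
  \<comment> \<open>A common format for all factors: over \<open>A\<close> the overlap with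
    \<open>d v\<close> matters, elsewhere staying inside the domain of \<open>c v\<close> is
    enough.\<close>
  define e where "e v = (if v \<in> A then d v else c v)" for v
  have e: "e v \<in> charts_at (Y v) (y v)" if "v \<in> B" for v
    using that charts_at_factor by (auto simp: e_def)
  let ?near = "\<lambda>h v. cmap (Y v) (c v) (y v) + (\<lambda>i. h (v, i))
      \<in> cmap (Y v) (c v) ` (cdom (Y v) (c v) \<inter> cdom (Y v) (e v))"
  have "\<forall>\<^sub>F h in fnhds0 (midx (prod_mfd B Y)). ?near h v" if "v \<in> B" for v
    using eventually_compose_filterlim[OF
        eventually_in_chart_overlap[OF mfd[rule_format, OF that] charts_at_factor(1)[OF that] e[OF that]]
        filterlim_slice[OF finite_midx_prod[OF fin mfd, unfolded prod_mfd_simps] that]]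
    unfolding prod_mfd_simps(2) .
  then have "\<forall>\<^sub>F h in fnhds0 (midx (prod_mfd B Y)). \<forall>v\<in>B. ?near h v"
    by (intro eventually_ball_finite fin) auto
  with eventually_fnhds0_fspace show ?thesis
  proof eventually_elim
    case (elim h)
    let ?w = "cmap (prod_mfd B Y) c y + h"
    have w: "(\<lambda>i. ?w (v, i)) = cmap (Y v) (c v) (y v) + (\<lambda>i. h (v, i))" if "v \<in> B" for v
      using that by auto
    have img: "\<forall>v\<in>B. (\<lambda>i. ?w (v, i)) \<in> cmap (Y v) (c v) ` cdom (Y v) (c v)"
    proof
      fix v assume v: "v \<in> B"
      with elim(2) have "cmap (Y v) (c v) (y v) + (\<lambda>i. h (v, i)) \<in> cmap (Y v) (c v) ` cdom (Y v) (c v)"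
        by blast
      then show "(\<lambda>i. ?w (v, i)) \<in> cmap (Y v) (c v) ` cdom (Y v) (c v)"
        by (simp only: w[OF v])
    qed
    have off: "\<forall>v. v \<notin> B \<longrightarrow> (\<forall>i. ?w (v, i) = 0)"
      using elim(1) by (simp add: fspace_def)
    note z = prod_cinv_eq[of B Y c ?w, OF fin mfd in_charts_prod(1) img off]
    define q where "q v = cinv (Y v) (c v) (cmap (Y v) (c v) (y v) + (\<lambda>i. h (v, i)))" for v
    have q: "cinv (prod_mfd B Y) c ?w v = q v" if "v \<in> B" for v
      unfolding z(3) q_def w[OF that, symmetric] using that by (rule restrict_apply')
    have dom: "q v \<in> cdom (Y v) (d v)" if v: "v \<in> A" for v
    proof -
      have vB: "v \<in> B" using v AB by auto
      then obtain x where x: "x \<in> cdom (Y v) (c v)" "x \<in> cdom (Y v) (d v)"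
        "cmap (Y v) (c v) (y v) + (\<lambda>i. h (v, i)) = cmap (Y v) (c v) x"
        using elim(2) v by (auto simp: e_def)
      have "inj_on (cmap (Y v) (c v)) (cdom (Y v) (c v))"
        using in_charts_prod(1) vB by (intro chart_inj_on mfd[rule_format]) auto
      with x(1) have "q v = x"
        unfolding q_def x(3) by (intro inv_into_f_f)
      with x(2) show ?thesis by simp
    qed
    have "?w \<in> cmap (prod_mfd B Y) c ` cdom (prod_mfd B Y) c"
      using z(1,2) by (intro image_eqI[OF sym])
    moreover have "restrict (cinv (prod_mfd B Y) c ?w) A \<in> cdom (prod_mfd A Y) d"
      unfolding prod_mfd_simps(4)[of A Y d]
    proof (intro restrict_PiE_iff[THEN iffD2] ballI)
      fix v assume v: "v \<in> A"
      with AB have "cinv (prod_mfd B Y) c ?w v = q v"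
        by (intro q) auto
      then show "cinv (prod_mfd B Y) c ?w v \<in> cdom (Y v) (d v)"
        using dom[OF v] by (simp only:)
    qed
    moreover have "\<forall>v\<in>A. cinv (prod_mfd B Y) c ?w v = q v"
      using q AB by blast
    ultimately show ?case
      unfolding q_def by (intro conjI)
  qed
qed

text \<open>The component at \<open>(v, i)\<close> is the component \<open>i\<close> of a transition
  in the factor \<open>v\<close>, applied to a slice of the increment; its error is small relative
  to the slice, hence relative to the whole increment.\<close>

lemma has_fderiv_prod_transition:
  "has_fderiv (midx (prod_mfd B Y)) (midx (prod_mfd A Y))
    (\<lambda>w. cmap (prod_mfd A Y) d (restrict (cinv (prod_mfd B Y) c w) A))
    (prod_dtrans A Y y c d) (cmap (prod_mfd B Y) c y)"
proof -
  let ?\<tau> = "\<lambda>w. cmap (prod_mfd A Y) d (restrict (cinv (prod_mfd B Y) c w) A)"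
  let ?u = "cmap (prod_mfd B Y) c y"
  have finA: "finite (midx (prod_mfd A Y))"
    using AB fin mfd by (intro finite_midx_prod) (auto intro: finite_subset)
  have trans: "has_fderiv (midx (Y v)) (midx (Y v)) (cmap (Y v) (d v) \<circ> cinv (Y v) (c v))
      (dtrans (Y v) (y v) (c v) (d v)) (cmap (Y v) (c v) (y v))" if "v \<in> A" for v
    using that AB by (intro has_fderiv_transition mfd[rule_format] charts_at_factor) auto
  show ?thesis
    unfolding has_fderiv_iff_components[OF finA]
  proof (intro conjI ballI allI impI)
    have lin: "linear (dtrans (Y v) (y v) (c v) (d v))" if "v \<in> A" for v
      using trans[OF that] by (rule has_fderiv_linear)
    show "linear (prod_dtrans A Y y c d)"
    proof (rule linearI)
      fix h k :: "'v \<times> 'i \<Rightarrow> real" and r :: real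
      have add: "dtrans (Y v) (y v) (c v) (d v) (\<lambda>i. (h + k) (v, i))
          = dtrans (Y v) (y v) (c v) (d v) (\<lambda>i. h (v, i)) + dtrans (Y v) (y v) (c v) (d v) (\<lambda>i. k (v, i))"
        if "v \<in> A" for v
        using linear_add[OF lin[OF that], of "\<lambda>i. h (v, i)" "\<lambda>i. k (v, i)"] by (simp only: plus_fun_def)
      show "prod_dtrans A Y y c d (h + k) = prod_dtrans A Y y c d h + prod_dtrans A Y y c d k"
        by (rule ext) (simp add: prod_dtrans_def case_prod_beta add[unfolded plus_fun_def] plus_fun_def)
      have scale: "dtrans (Y v) (y v) (c v) (d v) (\<lambda>i. (r *\<^sub>R h) (v, i))
          = r *\<^sub>R dtrans (Y v) (y v) (c v) (d v) (\<lambda>i. h (v, i))" if "v \<in> A" for v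
        using linear_scale[OF lin[OF that], of r "\<lambda>i. h (v, i)"] by (simp only: scaleR_fun_def)
      show "prod_dtrans A Y y c d (r *\<^sub>R h) = r *\<^sub>R prod_dtrans A Y y c d h"
        by (rule ext) (simp add: prod_dtrans_def case_prod_beta scale[unfolded scaleR_fun_def real_scaleR_def] scaleR_fun_def)
    qed
    show "prod_dtrans A Y y c d ` fspace (midx (prod_mfd B Y)) \<subseteq> fspace (midx (prod_mfd A Y))"
    proof clarify
      fix h assume h: "h \<in> fspace (midx (prod_mfd B Y))"
      have "dtrans (Y v) (y v) (c v) (d v) (\<lambda>i. h (v, i)) \<in> fspace (midx (Y v))" if "v \<in> A" for v
        using h by (intro has_fderiv_fspace[OF trans[OF that]]) (auto simp: fspace_def)
      then show "prod_dtrans A Y y c d h \<in> fspace (midx (prod_mfd A Y))"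
        by (auto simp: fspace_def prod_dtrans_def)
    qed
    fix k and \<epsilon> :: real assume k: "k \<in> midx (prod_mfd A Y)" and "\<epsilon> > 0"
    from k obtain v i where vi: "k = (v, i)" "v \<in> A" "i \<in> midx (Y v)" by auto
    have vB: "v \<in> B" using vi AB by auto
    let ?g = "cmap (Y v) (d v) \<circ> cinv (Y v) (c v)" and ?p = "cmap (Y v) (c v) (y v)"
    have "\<forall>\<^sub>F h in fnhds0 (midx (Y v)).
        \<bar>?g (?p + h) i - ?g ?p i - dtrans (Y v) (y v) (c v) (d v) h i\<bar> \<le> \<epsilon> * L2_set h (midx (Y v))"
      using trans[OF vi(2)] vi(3) \<open>\<epsilon> > 0\<close> finite_midx[OF mfd[rule_format, OF vB]]
      by (auto simp: has_fderiv_iff_components)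
    from eventually_compose_filterlim[OF this filterlim_slice[OF finite_midx_prod[OF fin mfd, unfolded prod_mfd_simps] vB]]
    have "\<forall>\<^sub>F h in fnhds0 (midx (prod_mfd B Y)).
        \<bar>?g (?p + (\<lambda>i. h (v, i))) i - ?g ?p i - dtrans (Y v) (y v) (c v) (d v) (\<lambda>i. h (v, i)) i\<bar>
          \<le> \<epsilon> * L2_set (\<lambda>i. h (v, i)) (midx (Y v))"
      unfolding prod_mfd_simps(2) .
    with eventually_prod_transition
    show "\<forall>\<^sub>F h in fnhds0 (midx (prod_mfd B Y)).
        \<bar>?\<tau> (?u + h) k - ?\<tau> ?u k - prod_dtrans A Y y c d h k\<bar> \<le> \<epsilon> * L2_set h (midx (prod_mfd B Y))"
    proof eventually_elim
      case (elim h)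
      have "cinv (prod_mfd B Y) c ?u = y"
        using prod_chart_inj_on[OF fin mfd in_charts_prod(1)] in_cdom_prod(1) by (rule inv_into_f_f)
      moreover have "cinv (Y v) (c v) ?p = y v"
        using in_charts_prod(1) in_cdom_prod(1) vB
        by (intro inv_into_f_f chart_inj_on mfd[rule_format]) (auto simp: PiE_iff)
      ultimately have eq: "?\<tau> (?u + h) k - ?\<tau> ?u k - prod_dtrans A Y y c d h k
          = ?g (?p + (\<lambda>i. h (v, i))) i - ?g ?p i - dtrans (Y v) (y v) (c v) (d v) (\<lambda>i. h (v, i)) i"
        using elim(1)[THEN conjunct2, THEN conjunct2, THEN bspec, OF vi(2)] vi(1,2)
        by (simp only: prod_dtrans_def prod_mfd_simps prod.case restrict_apply' if_True comp_apply)
      have "\<epsilon> * L2_set (\<lambda>i. h (v, i)) (midx (Y v)) \<le> \<epsilon> * L2_set h (midx (prod_mfd B Y))"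
        unfolding prod_mfd_simps using \<open>\<epsilon> > 0\<close>
        by (intro mult_left_mono L2_set_slice_le[OF finite_midx_prod[OF fin mfd, unfolded prod_mfd_simps] vB]) simp
      with elim(2) show ?case
        unfolding eq by (rule order_trans)
    qed
  qed
qed

text \<open>Chain rule for \<open>f\<close> read in \<open>d\<close>, composed with the restriction
  between the charts \<open>c\<close> and \<open>d\<close>. As \<open>c\<close> and \<open>d\<close>
  are arbitrary, it applies to independently chosen charts on the two products.\<close>

lemma has_fderiv_restrict:
  fixes N :: "('b, 'e, 'k) mfd"
  assumes "fdifferentiable (midx (prod_mfd A Y)) (midx N) (cmap N b \<circ> f \<circ> cinv (prod_mfd A Y) d)
      (cmap (prod_mfd A Y) d (restrict y A))"
  shows "has_fderiv (midx (prod_mfd B Y)) (midx N)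
      (cmap N b \<circ> (\<lambda>z. f (restrict z A)) \<circ> cinv (prod_mfd B Y) c)
      (fderiv (midx (prod_mfd A Y)) (midx N) (cmap N b \<circ> f \<circ> cinv (prod_mfd A Y) d)
        (cmap (prod_mfd A Y) d (restrict y A)) \<circ> prod_dtrans A Y y c d)
      (cmap (prod_mfd B Y) c y)"
proof -
  let ?\<tau> = "\<lambda>w. cmap (prod_mfd A Y) d (restrict (cinv (prod_mfd B Y) c w) A)"
  let ?u = "cmap (prod_mfd B Y) c y"
  have finA: "finite A" and mfdA: "\<forall>v\<in>A. smooth_manifold (Y v)"
    using AB fin mfd by (auto intro: finite_subset)
  have "cinv (prod_mfd B Y) c ?u = y"
    using prod_chart_inj_on[OF fin mfd in_charts_prod(1)] in_cdom_prod(1) by (rule inv_into_f_f)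
  then have \<tau>u: "?\<tau> ?u = cmap (prod_mfd A Y) d (restrict y A)"
    by simp
  have "has_fderiv (midx (prod_mfd B Y)) (midx N) ((cmap N b \<circ> f \<circ> cinv (prod_mfd A Y) d) \<circ> ?\<tau>)
      (fderiv (midx (prod_mfd A Y)) (midx N) (cmap N b \<circ> f \<circ> cinv (prod_mfd A Y) d)
        (cmap (prod_mfd A Y) d (restrict y A)) \<circ> prod_dtrans A Y y c d) ?u"
  proof (rule has_fderiv_chain[OF has_fderiv_prod_transition])
    show "finite (midx (prod_mfd B Y))" using fin mfd by (rule finite_midx_prod)
    show "finite (midx (prod_mfd A Y))" using finA mfdA by (rule finite_midx_prod)
    show "has_fderiv (midx (prod_mfd A Y)) (midx N) (cmap N b \<circ> f \<circ> cinv (prod_mfd A Y) d)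
      (fderiv (midx (prod_mfd A Y)) (midx N) (cmap N b \<circ> f \<circ> cinv (prod_mfd A Y) d)
        (cmap (prod_mfd A Y) d (restrict y A))) (?\<tau> ?u)"
      unfolding \<tau>u using assms by (rule fdifferentiableD)
    show "\<forall>\<^sub>F h in fnhds0 (midx (prod_mfd B Y)). ?\<tau> (?u + h) - ?\<tau> ?u \<in> fspace (midx (prod_mfd A Y))"
      using eventually_prod_transition
    proof eventually_elim
      case (elim h)
      have "?\<tau> (?u + h) \<in> fspace (midx (prod_mfd A Y))"
        using elim by (intro prod_chart_in_fspace[OF finA mfdA in_charts_prod(2)]) auto
      moreover have "?\<tau> ?u \<in> fspace (midx (prod_mfd A Y))"
        unfolding \<tau>u by (rule prod_chart_in_fspace[OF finA mfdA in_charts_prod(2) in_cdom_prod(2)])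
      ultimately
      show ?case by (simp add: fspace_def)
    qed
  qed
  \<comment> \<open>The factorization through \<open>d\<close> is valid only while the restricted
    point remains in the domain of \<open>d\<close>, so it is claimed near the base point.\<close>
  moreover have "\<forall>\<^sub>F h in fnhds0 (midx (prod_mfd B Y)).
      ((cmap N b \<circ> f \<circ> cinv (prod_mfd A Y) d) \<circ> ?\<tau>) (?u + h)
        = (cmap N b \<circ> (\<lambda>z. f (restrict z A)) \<circ> cinv (prod_mfd B Y) c) (?u + h)"
    using eventually_prod_transition
  proof eventually_elim
    case (elim h)
    then have "cinv (prod_mfd A Y) d (?\<tau> (?u + h)) = restrict (cinv (prod_mfd B Y) c (?u + h)) A"
      using prod_chart_inj_on[OF finA mfdA in_charts_prod(2)] by (intro inv_into_f_f) auto
    then show ?case by simp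
  qed
  ultimately show ?thesis
    using has_fderiv_cong by blast
qed

text \<open>In each factor this is the compatibility condition of \<open>tangent_space\<close>
  between the charts \<open>c v\<close> and \<open>d v\<close>; it makes the differential
  insensitive to the choice of charts.\<close>

lemma prod_dtrans_prod_tvec:
  assumes "X \<in> prod_tangent_space B Y y"
  shows "prod_dtrans A Y y c d (prod_tvec B Y y X c) = prod_tvec A Y (restrict y A) (zrestrict X A) d"
proof -
  have "dtrans (Y v) (y v) (c v) (d v) (X v (c v)) = X v (d v)" if "v \<in> A" for v
    using assms that AB charts_at_factor
    by (intro dtrans_tangent_space) (auto simp: prod_tangent_space_def)
  then show ?thesis
    using c d by (auto simp: prod_dtrans_def prod_tvec_def zrestrict_def fun_eq_iff)
qed

end

lemma prod_tvec_in_fspace: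
  assumes X: "X \<in> prod_tangent_space B Y y" and c: "c \<in> charts_at (prod_mfd B Y) y"
  shows "prod_tvec B Y y X c \<in> fspace (midx (prod_mfd B Y))"
proof -
  have "X v (c v) i = 0" if "(v, i) \<notin> midx (prod_mfd B Y)" for v i
  proof (cases "v \<in> B")
    case True
    then have "X v (c v) \<in> fspace (midx (Y v))"
      using X c by (intro tangent_space_in_fspace) (auto simp: prod_tangent_space_def charts_at_prod)
    with True that show ?thesis by (auto simp: fspace_def)
  next
    case False
    with X show ?thesis by (simp add: prod_tangent_space_def)
  qed
  with c show ?thesis
    by (auto simp: prod_tvec_def fspace_def simp del: prod_mfd_simps)
qed

lemma zrestrict_self: "X \<in> prod_tangent_space B Y y \<Longrightarrow> zrestrict X B = X"
  by (auto simp: prod_tangent_space_def zrestrict_def fun_eq_iff)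

text \<open>The case \<open>A = B\<close> of the restriction calculus. It links families of tangent
  vectors to \<open>tangent_space\<close> of the product, the space in which
  \<open>regular_value\<close> is expressed.\<close>

lemma prod_tvec_in_tangent_space:
  assumes fin: "finite B" and mfd: "\<forall>v\<in>B. smooth_manifold (Y v)"
    and X: "X \<in> prod_tangent_space B Y y"
  shows "prod_tvec B Y y X \<in> tangent_space (prod_mfd B Y) y"
proof -
  have "dtrans (prod_mfd B Y) y c d (prod_tvec B Y y X c) = prod_tvec B Y y X d"
    if c: "c \<in> charts_at (prod_mfd B Y) y" and d: "d \<in> charts_at (prod_mfd B Y) y" for c d
  proof -
    have y: "restrict y B = y"
      using c by (simp add: charts_at_prod extensional_restrict)
    have d': "d \<in> charts_at (prod_mfd B Y) (restrict y B)"
      using d by (simp add: y)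
    note ctx = fin mfd subset_refl c d'
    \<comment> \<open>Points of a product chart domain are extensional, so restricting them to
      \<open>B\<close> changes nothing.\<close>
    have "\<forall>\<^sub>F h in fnhds0 (midx (prod_mfd B Y)).
        (\<lambda>w. cmap (prod_mfd B Y) d (restrict (cinv (prod_mfd B Y) c w) B)) (cmap (prod_mfd B Y) c y + h)
          = (cmap (prod_mfd B Y) d \<circ> cinv (prod_mfd B Y) c) (cmap (prod_mfd B Y) c y + h)"
      using eventually_prod_transition[OF ctx]
    proof eventually_elim
      case (elim h)
      then have "cinv (prod_mfd B Y) c (cmap (prod_mfd B Y) c y + h) \<in> cdom (prod_mfd B Y) c"
        by (blast intro: inv_into_into)
      then have "cinv (prod_mfd B Y) c (cmap (prod_mfd B Y) c y + h) \<in> extensional B"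
        unfolding prod_mfd_simps by (simp only: PiE_iff)
      then show ?case
        by (simp add: extensional_restrict)
    qed
    from has_fderiv_cong[OF this] has_fderiv_prod_transition[OF ctx]
    have "has_fderiv (midx (prod_mfd B Y)) (midx (prod_mfd B Y))
        (cmap (prod_mfd B Y) d \<circ> cinv (prod_mfd B Y) c) (prod_dtrans B Y y c d) (cmap (prod_mfd B Y) c y)"
      by blast
    then have "dtrans (prod_mfd B Y) y c d (prod_tvec B Y y X c) = prod_dtrans B Y y c d (prod_tvec B Y y X c)"
      using prod_tvec_in_fspace[OF X c] finite_midx_prod[OF fin mfd] by (rule fderiv_eqI)
    also have "\<dots> = prod_tvec B Y y X d"
      using prod_dtrans_prod_tvec[OF ctx X] by (simp add: y zrestrict_self[OF X])
    finally show ?thesis .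
  qed
  moreover have "prod_tvec B Y y X c = 0" if "c \<notin> charts_at (prod_mfd B Y) y" for c
    using that by (simp add: prod_tvec_def)
  ultimately show ?thesis
    using prod_tvec_in_fspace[OF X] by (intro tangent_spaceI) auto
qed

section \<open>Differentials of maps on products\<close>

lemma linear_prod_tvec: "linear (\<lambda>X. prod_tvec A Y z X c)"
  by (intro linearI) (auto simp: prod_tvec_def scaleR_fun_apply fun_eq_iff)

text \<open>A name for the chart that \<open>tangent_map\<close> picks internally, so that facts
  about it can be stated.\<close>

definition base_chart :: "'v set \<Rightarrow> ('v \<Rightarrow> ('a, 'c, 'i) mfd) \<Rightarrow> ('v \<Rightarrow> 'a) \<Rightarrow> ('v \<Rightarrow> 'c)"
  where "base_chart A Y z = (SOME c. c \<in> charts_at (prod_mfd A Y) z)"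

lemma base_chart:
  assumes "finite A" "\<forall>v\<in>A. smooth_manifold (Y v)" "z \<in> pts (prod_mfd A Y)"
  shows "base_chart A Y z \<in> charts_at (prod_mfd A Y) z"
  unfolding base_chart_def using charts_at_prod_nonempty[OF assms] by (rule someI_ex)

lemma prod_diff_eq:
  "prod_diff A Y N F z X d =
    (if d \<in> charts_at N (F z)
     then fderiv (midx (prod_mfd A Y)) (midx N) (cmap N d \<circ> F \<circ> cinv (prod_mfd A Y) (base_chart A Y z))
       (cmap (prod_mfd A Y) (base_chart A Y z) z) (prod_tvec A Y z X (base_chart A Y z))
     else 0)"
  by (simp only: prod_diff_def tangent_map_def Let_def base_chart_def)

text \<open>Linear on all families, tangent or not: \<open>prod_tvec\<close> is linear in the
  family, and \<open>has_fderiv\<close> demands linearity on the whole function space.\<close>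

lemma linear_prod_diff:
  assumes A: "finite A" "\<forall>v\<in>A. smooth_manifold (Y v)" and z: "z \<in> pts (prod_mfd A Y)"
    and F: "differentiable_map (prod_mfd A Y) N F"
  shows "linear (prod_diff A Y N F z)"
proof -
  let ?c = "base_chart A Y z"
  note c = base_chart[OF A z]
  have lin: "linear (\<lambda>X. fderiv (midx (prod_mfd A Y)) (midx N) (cmap N d \<circ> F \<circ> cinv (prod_mfd A Y) ?c)
         (cmap (prod_mfd A Y) ?c z) (prod_tvec A Y z X ?c))" (is "linear (?D d)")
    if "d \<in> charts_at N (F z)" for d
  proof -
    have "fdifferentiable (midx (prod_mfd A Y)) (midx N) (cmap N d \<circ> F \<circ> cinv (prod_mfd A Y) ?c)
         (cmap (prod_mfd A Y) ?c z)"
      using F z c that unfolding differentiable_map_def by blast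
    from linear_compose[OF linear_prod_tvec has_fderiv_linear[OF fdifferentiableD[OF this]]]
    show ?thesis by (simp only: comp_def)
  qed
  show ?thesis
  proof (rule linearI)
    fix X X' and r :: real
    show "prod_diff A Y N F z (X + X') = prod_diff A Y N F z X + prod_diff A Y N F z X'"
    proof
      fix d show "prod_diff A Y N F z (X + X') d = (prod_diff A Y N F z X + prod_diff A Y N F z X') d"
        using linear_add[OF lin, of d X X']
          by (cases "d \<in> charts_at N (F z)") (simp_all only: prod_diff_eq plus_fun_apply if_True if_False add_0)
    qed
    show "prod_diff A Y N F z (r *\<^sub>R X) = r *\<^sub>R prod_diff A Y N F z X"
    proof
      fix d show "prod_diff A Y N F z (r *\<^sub>R X) d = (r *\<^sub>R prod_diff A Y N F z X) d"
        using linear_scale[OF lin, of d r X]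
        by (cases "d \<in> charts_at N (F z)") (simp_all only: prod_diff_eq scaleR_fun_apply if_True if_False scaleR_zero_right)
    qed
  qed
qed

lemma linear_prod_rdiff:
  assumes "finite A" "\<forall>v\<in>A. smooth_manifold (Y v)" "z \<in> pts (prod_mfd A Y)"
    and "differentiable_map (prod_mfd A Y) real_line F"
  shows "linear (prod_rdiff A Y F z)"
  using linear_add[OF linear_prod_diff[OF assms]] linear_scale[OF linear_prod_diff[OF assms]]
  by (intro linearI) (simp_all only: prod_rdiff_def plus_fun_apply scaleR_fun_apply)

lemma charts_at_real_line: "charts_at real_line x = UNIV"
  by (simp add: charts_at_def real_line_def)

text \<open>Each summand sees only the factors in \<open>A a\<close>. Its derivative in the base
  chart of the large product is computed through the base chart of its own product; the derivatives
  are then added and uniqueness identifies the sum with \<open>fderiv\<close>.\<close>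

lemma prod_rdiff_sum_restrict:
  fixes Y :: "'v \<Rightarrow> ('a, 'c, 'i) mfd"
  assumes B: "finite B" "\<forall>v\<in>B. smooth_manifold (Y v)" and R: "finite R"
    and AB: "\<forall>a\<in>R. A a \<subseteq> B" and y: "y \<in> pts (prod_mfd B Y)"
    and L: "\<forall>a\<in>R. differentiable_map (prod_mfd (A a) Y) real_line (L a)"
    and X: "X \<in> prod_tangent_space B Y y"
  shows "prod_rdiff B Y (\<lambda>z. \<Sum>a\<in>R. L a (restrict z (A a))) y X =
    (\<Sum>a\<in>R. prod_rdiff (A a) Y (L a) (restrict y (A a)) (zrestrict X (A a)))"
proof -
  let ?c = "base_chart B Y y"
  note c = base_chart[OF B y]
  let ?H = "\<lambda>a. cmap real_line () \<circ> (\<lambda>z. L a (restrict z (A a))) \<circ> cinv (prod_mfd B Y) ?c"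
  have "\<exists>D. has_fderiv (midx (prod_mfd B Y)) (midx real_line) (?H a) D (cmap (prod_mfd B Y) ?c y) \<and>
      D (prod_tvec B Y y X ?c) () = prod_rdiff (A a) Y (L a) (restrict y (A a)) (zrestrict X (A a))"
    if a: "a \<in> R" for a
  proof -
    have A: "A a \<subseteq> B" "finite (A a)" "\<forall>v\<in>A a. smooth_manifold (Y v)"
      using AB B a by (auto intro: finite_subset)
    have ya: "restrict y (A a) \<in> pts (prod_mfd (A a) Y)"
      using y A(1) by (auto simp: PiE_iff)
    let ?d = "base_chart (A a) Y (restrict y (A a))"
    note d = base_chart[OF A(2,3) ya]
    have "fdifferentiable (midx (prod_mfd (A a) Y)) (midx real_line)
        (cmap real_line () \<circ> L a \<circ> cinv (prod_mfd (A a) Y) ?d) (cmap (prod_mfd (A a) Y) ?d (restrict y (A a)))"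
      using L a ya d unfolding differentiable_map_def by (auto simp: charts_at_real_line)
    from has_fderiv_restrict[OF B A(1) c d this] prod_dtrans_prod_tvec[OF B A(1) c d X]
    show ?thesis
      by (intro exI conjI) (assumption, simp only: comp_def prod_rdiff_def prod_diff_eq charts_at_real_line UNIV_I if_True)
  qed
  then obtain D where D: "\<And>a. a \<in> R \<Longrightarrow> has_fderiv (midx (prod_mfd B Y)) (midx real_line) (?H a) (D a) (cmap (prod_mfd B Y) ?c y)"
    "\<And>a. a \<in> R \<Longrightarrow> D a (prod_tvec B Y y X ?c) () = prod_rdiff (A a) Y (L a) (restrict y (A a)) (zrestrict X (A a))"
    by metis
  have sum_apply: "(\<Sum>a\<in>R. f a) k = (\<Sum>a\<in>R. f a k)" for f :: "'b \<Rightarrow> unit \<Rightarrow> real" and k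
    using R by (induction R) simp_all
  have "(cmap real_line () \<circ> (\<lambda>z. \<Sum>a\<in>R. L a (restrict z (A a))) \<circ> cinv (prod_mfd B Y) ?c) = (\<lambda>w. \<Sum>a\<in>R. ?H a w)"
    by (intro ext) (simp only: comp_def sum_apply, simp add: real_line_def)
  moreover have "has_fderiv (midx (prod_mfd B Y)) (midx real_line) (\<lambda>w. \<Sum>a\<in>R. ?H a w) (\<lambda>h. \<Sum>a\<in>R. D a h) (cmap (prod_mfd B Y) ?c y)"
    using R D(1) by (rule has_fderiv_sum)
  moreover have "finite (midx real_line)"
    by (simp add: real_line_def)
  ultimately have "fderiv (midx (prod_mfd B Y)) (midx real_line)
      (cmap real_line () \<circ> (\<lambda>z. \<Sum>a\<in>R. L a (restrict z (A a))) \<circ> cinv (prod_mfd B Y) ?c) (cmap (prod_mfd B Y) ?c y)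
      (prod_tvec B Y y X ?c) = (\<Sum>a\<in>R. D a (prod_tvec B Y y X ?c))"
    using prod_tvec_in_fspace[OF X c] by (simp only: fderiv_eqI)
  then have "prod_rdiff B Y (\<lambda>z. \<Sum>a\<in>R. L a (restrict z (A a))) y X = (\<Sum>a\<in>R. D a (prod_tvec B Y y X ?c) ())"
    by (simp only: prod_rdiff_def prod_diff_eq charts_at_real_line UNIV_I if_True sum_apply)
  also have "\<dots> = (\<Sum>a\<in>R. prod_rdiff (A a) Y (L a) (restrict y (A a)) (zrestrict X (A a)))"
    using D(2) by (rule sum.cong[OF refl])
  finally show ?thesis .
qed

text \<open>Translation by the inverse of the identity is the identity on the carrier, so its
  differential consists of transition derivatives, which carry a tangent vector from the chosen
  chart to its own entries.\<close>

lemma maurer_cartan_one: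
  assumes lie: "lie_group M G" and \<xi>: "\<xi> \<in> tangent_space M \<one>\<^bsub>G\<^esub>"
  shows "maurer_cartan M G \<one>\<^bsub>G\<^esub> \<xi> = \<xi>"
proof -
  interpret group G
    using lie by (simp add: lie_group_def)
  have M: "smooth_manifold M" and pts: "carrier G = pts M"
    using lie by (simp_all add: lie_group_def)
  define c where "c = (SOME c. c \<in> charts_at M \<one>\<^bsub>G\<^esub>)"
  have "\<one>\<^bsub>G\<^esub> \<in> pts M"
    using one_closed by (simp only: pts)
  then have c: "c \<in> charts_at M \<one>\<^bsub>G\<^esub>"
    unfolding c_def by (intro someI_ex[OF charts_at_nonempty[OF M]])
  let ?f = "\<lambda>h. inv\<^bsub>G\<^esub> \<one>\<^bsub>G\<^esub> \<otimes>\<^bsub>G\<^esub> h"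
  have f1: "?f \<one>\<^bsub>G\<^esub> = \<one>\<^bsub>G\<^esub>" by simp
  \<comment> \<open>The translation is known to be the identity only on the carrier of
    \<open>G\<close>; the chart domain lies inside it, so the derivatives are compared
    locally.\<close>
  have "fderiv (midx M) (midx M) (cmap M d \<circ> ?f \<circ> cinv M c) (cmap M c \<one>\<^bsub>G\<^esub>) = dtrans M \<one>\<^bsub>G\<^esub> c d" for d
  proof (rule fderiv_cong)
    show "\<forall>\<^sub>F h in fnhds0 (midx M). (cmap M d \<circ> ?f \<circ> cinv M c) (cmap M c \<one>\<^bsub>G\<^esub> + h) =
        (cmap M d \<circ> cinv M c) (cmap M c \<one>\<^bsub>G\<^esub> + h)"
      using eventually_in_chart_overlap[OF M c c]
    proof eventually_elim
      case (elim h)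
      then have "cinv M c (cmap M c \<one>\<^bsub>G\<^esub> + h) \<in> cdom M c"
        by (intro inv_into_into) auto
      moreover have "cdom M c \<subseteq> pts M"
        using c by (intro openin_subset chart_homeomorphic(2)[OF M]) (simp add: charts_at_def)
      ultimately have "cinv M c (cmap M c \<one>\<^bsub>G\<^esub> + h) \<in> carrier G"
        unfolding pts by blast
      then show ?case
        by (simp only: comp_apply inv_one l_one)
    qed
  qed
  then have "maurer_cartan M G \<one>\<^bsub>G\<^esub> \<xi> d = (if d \<in> charts_at M \<one>\<^bsub>G\<^esub> then dtrans M \<one>\<^bsub>G\<^esub> c d (\<xi> c) else 0)" for d
    unfolding maurer_cartan_def tangent_map_def Let_def f1 c_def[symmetric] by simp
  then show ?thesis
    using dtrans_tangent_space[OF \<xi> c] tangent_space_off_charts[OF \<xi>] by (intro ext) simp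
qed

section \<open>Linear Lagrange multipliers\<close>

lemma dual_space_simps:
  assumes "l \<in> dual_space W"
  shows "x \<in> W \<Longrightarrow> y \<in> W \<Longrightarrow> l (x + y) = l x + l y" and "x \<in> W \<Longrightarrow> l (r *\<^sub>R x) = r * l x"
  using assms by (simp_all add: dual_space_def)

lemma dual_space_zero: "l \<in> dual_space W \<Longrightarrow> subspace W \<Longrightarrow> l 0 = 0"
  using dual_space_simps(2)[of l W 0 0] by (simp add: subspace_0)

lemma dual_space_ext:
  assumes "l \<in> dual_space W" "l' \<in> dual_space W" "\<And>x. x \<in> W \<Longrightarrow> l x = l' x"
  shows "l = l'"
  using assms by (intro extensionalityI[of l W l']) (auto simp: dual_space_def)

text \<open>Surjectivity yields \<open>s a \<xi>\<close> in \<open>V\<close> with constraint value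
  \<open>\<xi>\<close> at \<open>a\<close> and zero at the other indices. Testing with it forces
  \<open>l a \<xi> = - f (s a \<xi>)\<close>, which gives uniqueness and dictates the definition for
  existence. That definition works because \<open>f\<close> vanishes on the common kernel and so
  depends on the constraint values only.\<close>

lemma
  fixes \<theta> :: "'r \<Rightarrow> 'b::real_vector \<Rightarrow> 'w::real_vector" and f :: "'b \<Rightarrow> real"
  assumes V: "subspace V" and W: "subspace W" and R: "finite R"
    and lin: "\<And>a. a \<in> R \<Longrightarrow> linear (\<theta> a)" and f: "linear f"
    and onto: "(\<lambda>X. \<lambda>a\<in>R. \<theta> a X) ` V = (R \<rightarrow>\<^sub>E W)"
  shows lagrange_multiplier_iff: "(\<forall>X\<in>V. (\<forall>a\<in>R. \<theta> a X = 0) \<longrightarrow> f X = 0) \<longleftrightarrow>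
      (\<exists>l \<in> R \<rightarrow>\<^sub>E dual_space W. \<forall>X\<in>V. f X + (\<Sum>a\<in>R. l a (\<theta> a X)) = 0)" (is "?K \<longleftrightarrow> ?E")
    and lagrange_multiplier_unique: "\<And>l l'. l \<in> R \<rightarrow>\<^sub>E dual_space W \<Longrightarrow> l' \<in> R \<rightarrow>\<^sub>E dual_space W \<Longrightarrow>
      \<forall>X\<in>V. f X + (\<Sum>a\<in>R. l a (\<theta> a X)) = 0 \<Longrightarrow> \<forall>X\<in>V. f X + (\<Sum>a\<in>R. l' a (\<theta> a X)) = 0 \<Longrightarrow> l = l'"
proof -
  have ex: "\<exists>X. X \<in> V \<and> \<theta> a X = \<xi> \<and> (\<forall>b\<in>R. b \<noteq> a \<longrightarrow> \<theta> b X = 0)" if "a \<in> R" "\<xi> \<in> W" for a \<xi>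
  proof -
    have "(\<lambda>b\<in>R. if b = a then \<xi> else 0) \<in> (\<lambda>X. \<lambda>a\<in>R. \<theta> a X) ` V"
      unfolding onto using that subspace_0[OF W] by auto
    then obtain X where X: "X \<in> V" "(\<lambda>b\<in>R. if b = a then \<xi> else 0) = (\<lambda>a\<in>R. \<theta> a X)" by blast
    have "\<theta> b X = (if b = a then \<xi> else 0)" if "b \<in> R" for b
      using fun_cong[OF X(2), of b] that by simp
    with X(1) that show ?thesis by (intro exI[of _ X]) auto
  qed
  define s where "s a \<xi> = (SOME X. X \<in> V \<and> \<theta> a X = \<xi> \<and> (\<forall>b\<in>R. b \<noteq> a \<longrightarrow> \<theta> b X = 0))" for a \<xi>
  have s: "s a \<xi> \<in> V" "\<theta> a (s a \<xi>) = \<xi>" "\<And>b. b \<in> R \<Longrightarrow> b \<noteq> a \<Longrightarrow> \<theta> b (s a \<xi>) = 0"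
    if "a \<in> R" "\<xi> \<in> W" for a \<xi>
    using someI_ex[OF ex[OF that]] unfolding s_def[symmetric] by blast+
  have in_W: "\<theta> a X \<in> W" if "a \<in> R" "X \<in> V" for a X
  proof -
    have "(\<lambda>a\<in>R. \<theta> a X) \<in> R \<rightarrow>\<^sub>E W" unfolding onto[symmetric] using that by blast
    then show ?thesis using that by (auto simp: PiE_iff)
  qed
  \<comment> \<open>Testing with \<open>s a \<xi>\<close> isolates one multiplier: at the other
    indices it is applied to zero, which lies in \<open>W\<close>.\<close>
  have sum_s: "(\<Sum>b\<in>R. l b (\<theta> b (s a \<xi>))) = l a \<xi>"
    if l: "l \<in> R \<rightarrow>\<^sub>E dual_space W" and a: "a \<in> R" "\<xi> \<in> W" for l a \<xi>
  proof -
    have "(\<Sum>b\<in>R. l b (\<theta> b (s a \<xi>))) = (\<Sum>b\<in>R. if b = a then l a \<xi> else 0)"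
    proof (rule sum.cong[OF refl])
      fix b assume "b \<in> R"
      moreover from this l have "l b 0 = 0" by (intro dual_space_zero[OF _ W]) auto
      ultimately show "l b (\<theta> b (s a \<xi>)) = (if b = a then l a \<xi> else 0)"
        using s(2,3) a by simp
    qed
    then show ?thesis using R a by simp
  qed
  show "l = l'" if l: "l \<in> R \<rightarrow>\<^sub>E dual_space W" "\<forall>X\<in>V. f X + (\<Sum>a\<in>R. l a (\<theta> a X)) = 0"
    and l': "l' \<in> R \<rightarrow>\<^sub>E dual_space W" "\<forall>X\<in>V. f X + (\<Sum>a\<in>R. l' a (\<theta> a X)) = 0" for l l'
  proof (rule PiE_ext[OF l(1) l'(1)])
    fix a assume a: "a \<in> R"
    show "l a = l' a"
    proof (rule dual_space_ext)
      show "l a \<in> dual_space W" "l' a \<in> dual_space W" using l l' a by auto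
      fix \<xi> assume \<xi>: "\<xi> \<in> W"
      have "f (s a \<xi>) + l a \<xi> = 0" "f (s a \<xi>) + l' a \<xi> = 0"
        using l(2) l'(2) s(1)[OF a \<xi>] sum_s[OF l(1) a \<xi>] sum_s[OF l'(1) a \<xi>] by force+
      then show "l a \<xi> = l' a \<xi>" by linarith
    qed
  qed
  show "?K \<longleftrightarrow> ?E"
  proof
    assume K: ?K
    have f_eq: "f X = f X'" if "X \<in> V" "X' \<in> V" "\<And>a. a \<in> R \<Longrightarrow> \<theta> a X = \<theta> a X'" for X X'
    proof -
      have "X - X' \<in> V" using V that by (intro subspace_diff)
      moreover have "\<theta> a (X - X') = 0" if "a \<in> R" for a
        using linear_diff[OF lin[OF that], of X X'] \<open>\<And>a. a \<in> R \<Longrightarrow> \<theta> a X = \<theta> a X'\<close>[OF that] by simp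
      ultimately have "f (X - X') = 0" using K by blast
      then show ?thesis using linear_diff[OF f, of X X'] by simp
    qed
    \<comment> \<open>\<open>s\<close> need not be linear, but \<open>f\<close> does not see the choice of the preimage.\<close>
    define l where "l = (\<lambda>a\<in>R. \<lambda>\<xi>\<in>W. - f (s a \<xi>))"
    have "l a \<in> dual_space W" if a: "a \<in> R" for a
      unfolding dual_space_def
    proof (intro CollectI conjI ballI allI)
      show "l a \<in> extensional W" using a by (simp add: l_def)
      fix x assume x: "x \<in> W"
      show "l a (x + y) = l a x + l a y" if y: "y \<in> W" for y
      proof -
        have "f (s a (x + y)) = f (s a x + s a y)"
        proof (rule f_eq)
          show "\<theta> b (s a (x + y)) = \<theta> b (s a x + s a y)" if "b \<in> R" for b
            using a x y that s(2,3) subspace_add[OF W x y] linear_add[OF lin[OF that], of "s a x" "s a y"]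
            by (cases "b = a") simp_all
        qed (use a x y s(1) V W in \<open>auto intro: subspace_add\<close>)
        then show ?thesis
          using a x y subspace_add[OF W x y] linear_add[OF f] by (simp add: l_def)
      qed
      show "l a (r *\<^sub>R x) = r * l a x" for r
      proof -
        have "f (s a (r *\<^sub>R x)) = f (r *\<^sub>R s a x)"
        proof (rule f_eq)
          show "\<theta> b (s a (r *\<^sub>R x)) = \<theta> b (r *\<^sub>R s a x)" if "b \<in> R" for b
            using a x that s(2,3) subspace_scale[OF W x] linear_scale[OF lin[OF that], of r "s a x"]
            by (cases "b = a") simp_all
        qed (use a x s(1) V W in \<open>auto intro: subspace_scale\<close>)
        then show ?thesis
          using a x subspace_scale[OF W x] linear_scale[OF f] by (simp add: l_def)
      qed
    qed
    then have "l \<in> R \<rightarrow>\<^sub>E dual_space W" by (auto simp: l_def)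
    moreover have "f X + (\<Sum>a\<in>R. l a (\<theta> a X)) = 0" if X: "X \<in> V" for X
    proof -
      \<comment> \<open>\<open>X\<close> may be replaced by the sum of the chosen preimages of its
        constraint values, as both have the same constraint values.\<close>
      have "f X = f (\<Sum>a\<in>R. s a (\<theta> a X))"
      proof (rule f_eq[OF X])
        show "(\<Sum>a\<in>R. s a (\<theta> a X)) \<in> V"
          using V s(1) in_W X by (intro subspace_sum) auto
        fix b assume b: "b \<in> R"
        have "\<theta> b (\<Sum>a\<in>R. s a (\<theta> a X)) = (\<Sum>a\<in>R. \<theta> b (s a (\<theta> a X)))"
          using lin[OF b] by (rule linear_sum)
        also have "\<dots> = (\<Sum>a\<in>R. if a = b then \<theta> b X else 0)"
          using s(2,3) b in_W[OF _ X] by (intro sum.cong) auto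
        finally show "\<theta> b X = \<theta> b (\<Sum>a\<in>R. s a (\<theta> a X))"
          using R b by simp
      qed
      also have "\<dots> = (\<Sum>a\<in>R. f (s a (\<theta> a X)))"
        using f by (rule linear_sum)
      also have "\<dots> = - (\<Sum>a\<in>R. l a (\<theta> a X))"
        unfolding sum_negf[symmetric] using in_W X by (intro sum.cong) (auto simp: l_def)
      finally show ?thesis by simp
    qed
    ultimately show ?E by blast
  next
    assume ?E
    then obtain l where l: "l \<in> R \<rightarrow>\<^sub>E dual_space W" "\<forall>X\<in>V. f X + (\<Sum>a\<in>R. l a (\<theta> a X)) = 0"
      by blast
    have "l a 0 = 0" if "a \<in> R" for a
      using l(1) that by (intro dual_space_zero[OF _ W]) auto
    with l(2) show ?K by force
  qed
qed

section \<open>The variational problem\<close>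

locale regular_lagrange_problem =
  fixes C :: "'x cell_complex" and n :: nat and Y :: "'x \<Rightarrow> ('a, 'c, 'i) mfd"
    and M :: "('g, 'd, 'k) mfd" and G :: "'g monoid"
    and \<Phi> :: "'x \<Rightarrow> ('x \<Rightarrow> 'a) \<Rightarrow> 'g" and L :: "'x \<Rightarrow> ('x \<Rightarrow> 'a) \<Rightarrow> real"
    and R :: "'x set" and y :: "'x \<Rightarrow> 'a"
  assumes finite_R: "finite R" and faces: "R \<subseteq> cells C n"
    and finite_verts: "\<forall>a\<in>cells C n. finite (verts C a)"
    and fibers: "\<forall>v\<in>cells C 0. smooth_manifold (Y v)"
    and lie: "lie_group M G"
    and L: "\<forall>a\<in>cells C n. differentiable_map (J1 C Y a) real_line (L a)"
    and \<Phi>: "\<forall>a\<in>cells C n. differentiable_map (J1 C Y a) M (\<Phi> a)"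
    and regular_value: "\<forall>a\<in>cells C n. regular_value (J1 C Y a) M (\<Phi> a) \<one>\<^bsub>G\<^esub>"
    and admissible: "y \<in> admissible_sections C Y G \<Phi> R"
    and regular: "regular_section n C Y M G \<Phi> R y"
begin

text \<open>Caution: in the linear multiplier lemma this space takes the place of \<open>V\<close>,
  and the Lie algebra that of \<open>W\<close>.\<close>

abbreviation W where "W \<equiv> fixed_boundary_variations n C Y R y"

text \<open>Without the Maurer-Cartan form, as in the definition of admissible variations;
  \<open>theta_dPhi_eq\<close> matches it with the map in the definition of regularity.\<close>

definition dPhi where "dPhi a X = prod_diff (verts C a) Y M (\<Phi> a) (j1 C y a) (j1t C X a)"

definition dL where "dL a X = prod_rdiff (verts C a) Y (L a) (j1 C y a) (j1t C X a)"

text \<open>The same shape as the argument built by \<open>form_component\<close>, so that Cartan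
  forms unfold to differentials along it.\<close>

definition single :: "'x \<Rightarrow> ('c, 'i) tvec \<Rightarrow> ('x, 'c, 'i) tfam"
  where "single v \<xi> = (\<lambda>_. 0)(v := \<xi>)"

lemma verts_subset: "a \<in> R \<Longrightarrow> verts C a \<subseteq> region_verts C R"
  by (auto simp: verts_def region_verts_def)

lemma region_verts_eq: "region_verts C R = (\<Union>a\<in>R. verts C a)"
  by (auto simp: verts_def region_verts_def)

lemma finite_verts_face: "a \<in> R \<Longrightarrow> finite (verts C a)"
  using faces finite_verts by auto

lemma finite_region_verts: "finite (region_verts C R)"
  unfolding region_verts_eq using finite_R finite_verts_face by blast

lemma manifold_region: "\<forall>v\<in>region_verts C R. smooth_manifold (Y v)"
  using fibers by (auto simp: region_verts_def)

lemma manifold_verts: "\<forall>v\<in>verts C a. smooth_manifold (Y v)"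
  using fibers by (auto simp: verts_def)

lemma y_pts: "y \<in> pts (prod_mfd (region_verts C R) Y)"
  using admissible by (simp only: admissible_sections_def sections_def mem_Collect_eq)

lemma j1_pts: "a \<in> R \<Longrightarrow> j1 C y a \<in> pts (J1 C Y a)"
  using y_pts verts_subset[of a] by (auto simp: j1_def PiE_iff)

lemma Phi_j1: "a \<in> R \<Longrightarrow> \<Phi> a (j1 C y a) = \<one>\<^bsub>G\<^esub>"
  using admissible by (simp add: admissible_sections_def)

lemma subspace_lie_algebra: "subspace (lie_algebra M G)"
  using lie unfolding lie_algebra_def lie_group_def by (intro tangent_space_subspace) blast

lemma linear_j1t: "linear (\<lambda>X. j1t C X a)"
  by (intro linearI) (auto simp: j1t_def zrestrict_def scaleR_fun_apply fun_eq_iff)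

lemma linear_dPhi: "a \<in> R \<Longrightarrow> linear (dPhi a)"
  using linear_compose[OF linear_j1t linear_prod_diff[OF finite_verts_face manifold_verts j1_pts]] \<Phi> faces
  unfolding dPhi_def[abs_def] comp_def by blast

lemma linear_dL: "a \<in> R \<Longrightarrow> linear (dL a)"
  using linear_compose[OF linear_j1t linear_prod_rdiff[OF finite_verts_face manifold_verts j1_pts]] L faces
  unfolding dL_def[abs_def] comp_def by blast

lemma j1t_tangent:
  assumes "a \<in> R" "X \<in> variations C Y R y"
  shows "j1t C X a \<in> prod_tangent_space (verts C a) Y (j1 C y a)"
  using assms verts_subset[of a]
  by (auto simp: variations_def prod_tangent_space_def j1t_def j1_def zrestrict_def)

lemma dPhi_in_lie_algebra:
  assumes a: "a \<in> R" and X: "X \<in> variations C Y R y"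
  shows "dPhi a X \<in> lie_algebra M G"
proof -
  \<comment> \<open>That \<open>e\<close> is a regular value gives the inclusion \<open>d\<Phi>(T J\<^sup>1Y) \<subseteq> T\<^sub>eG\<close> without a chain rule in \<open>G\<close>.\<close>
  have "tangent_map (J1 C Y a) M (\<Phi> a) (j1 C y a) ` tangent_space (J1 C Y a) (j1 C y a)
      = tangent_space M \<one>\<^bsub>G\<^esub>"
    using regular_value a faces j1_pts[OF a] Phi_j1[OF a] unfolding regular_value_def by blast
  moreover have "prod_tvec (verts C a) Y (j1 C y a) (j1t C X a) \<in> tangent_space (J1 C Y a) (j1 C y a)"
    using finite_verts_face[OF a] manifold_verts j1t_tangent[OF a X] by (rule prod_tvec_in_tangent_space)
  ultimately show ?thesis
    unfolding dPhi_def prod_diff_def lie_algebra_def by blast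
qed

lemma theta_dPhi_eq:
  assumes "a \<in> R" "X \<in> variations C Y R y"
  shows "theta_dPhi C Y M G \<Phi> a (j1 C y a) (j1t C X a) = dPhi a X"
  using maurer_cartan_one[OF lie] dPhi_in_lie_algebra[OF assms]
  by (simp add: theta_dPhi_def dPhi_def lie_algebra_def Phi_j1[OF assms(1)])

lemma subspace_variations: "subspace (variations C Y R y)"
proof (rule subspaceI)
  have sub: "subspace (tangent_space (Y v) (y v))" if "v \<in> region_verts C R" for v
    using manifold_region that by (intro tangent_space_subspace) auto
  show "0 \<in> variations C Y R y"
    using subspace_0[OF sub] by (simp add: variations_def prod_tangent_space_def)
  show "X + X' \<in> variations C Y R y" if "X \<in> variations C Y R y" "X' \<in> variations C Y R y" for X X'
    using that subspace_add[OF sub] by (simp add: variations_def prod_tangent_space_def)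
  show "r *\<^sub>R X \<in> variations C Y R y" if "X \<in> variations C Y R y" for r X
    using that subspace_scale[OF sub] by (simp add: variations_def prod_tangent_space_def scaleR_fun_apply)
qed

lemma W_variations: "X \<in> W \<Longrightarrow> X \<in> variations C Y R y"
  by (simp add: fixed_boundary_variations_def)

lemma subspace_W: "subspace W"
proof (rule subspaceI)
  note sv = subspace_variations
  show "0 \<in> W"
    using subspace_0[OF sv] by (simp add: fixed_boundary_variations_def)
  show "X + X' \<in> W" if "X \<in> W" "X' \<in> W" for X X'
    using that subspace_add[OF sv] by (simp add: fixed_boundary_variations_def)
  show "r *\<^sub>R X \<in> W" if "X \<in> W" for r X
    using that subspace_scale[OF sv] by (simp add: fixed_boundary_variations_def scaleR_fun_apply)
qed

lemma dPhi_onto: "(\<lambda>X. \<lambda>a\<in>R. dPhi a X) ` W = (R \<rightarrow>\<^sub>E lie_algebra M G)"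
proof -
  have "(\<lambda>X. \<lambda>a\<in>R. dPhi a X) ` W
      = (\<lambda>X. \<lambda>a\<in>R. theta_dPhi C Y M G \<Phi> a (j1 C y a) (j1t C X a)) ` W"
    by (intro image_cong restrict_ext refl theta_dPhi_eq[symmetric] W_variations)
  with regular show ?thesis
    by (simp only: regular_section_def)
qed

lemma action_diff:
  assumes "X \<in> variations C Y R y"
  shows "prod_rdiff (region_verts C R) Y (action C L R) y X = (\<Sum>a\<in>R. dL a X)"
proof -
  have "prod_rdiff (region_verts C R) Y (\<lambda>z. \<Sum>a\<in>R. L a (restrict z (verts C a))) y X =
      (\<Sum>a\<in>R. prod_rdiff (verts C a) Y (L a) (restrict y (verts C a)) (zrestrict X (verts C a)))"
    using assms L faces verts_subset unfolding variations_def
    by (intro prod_rdiff_sum_restrict finite_region_verts manifold_region finite_R y_pts) auto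
  then show ?thesis
    by (simp only: action_def[abs_def] j1_def dL_def j1t_def)
qed

lemma critical_iff:
  "critical_fixed_boundary n C Y M G \<Phi> L R y \<longleftrightarrow>
    (\<forall>X\<in>W. (\<forall>a\<in>R. dPhi a X = 0) \<longrightarrow> (\<Sum>a\<in>R. dL a X) = 0)"
  using admissible W_variations action_diff
  by (auto simp: critical_fixed_boundary_def admissible_variations_def dPhi_def)

section \<open>Variations supported at a single interior vertex\<close>

lemma single_variation:
  assumes "v \<in> interior_verts n C R" "\<xi> \<in> tangent_space (Y v) (y v)"
  shows "single v \<xi> \<in> W"
proof -
  have "0 \<in> tangent_space (Y w) (y w)" if "w \<in> region_verts C R" for w
    using manifold_region that by (intro subspace_0 tangent_space_subspace) auto
  with assms show ?thesis
    by (auto simp: fixed_boundary_variations_def variations_def prod_tangent_space_def single_def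
        frontier_verts_def interior_verts_def)
qed

lemma j1t_single:
  "v \<in> verts C a \<Longrightarrow> j1t C (single v \<xi>) a = single v \<xi>"
  "v \<notin> verts C a \<Longrightarrow> j1t C (single v \<xi>) a = 0"
  by (auto simp: j1t_def single_def zrestrict_def fun_eq_iff)

text \<open>For an interior vertex the star stays within the region, so sums over the star, as in
  the multiplier equations, are parts of sums over \<open>R\<close>, as in the action.\<close>

lemma star_interior:
  assumes "v \<in> interior_verts n C R"
  shows "star n C v = {a\<in>R. v \<in> verts C a}"
  using assms faces by (auto simp: interior_verts_def region_verts_def star_def verts_def)

text \<open>The differential at \<open>y\<close> of the action augmented by the multiplier
  terms.\<close>

definition multiplier_form :: "('x \<Rightarrow> ('d, 'k) tvec \<Rightarrow> real) \<Rightarrow> ('x, 'c, 'i) tfam \<Rightarrow> real"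
  where "multiplier_form l X = (\<Sum>a\<in>R. dL a X) + (\<Sum>a\<in>R. l a (dPhi a X))"

text \<open>Restricted to variations because their constraint differentials lie in the Lie algebra,
  where the multipliers are additive.\<close>

lemma multiplier_form_add:
  assumes l: "l \<in> R \<rightarrow>\<^sub>E dual_space (lie_algebra M G)"
    and X: "X \<in> variations C Y R y" and X': "X' \<in> variations C Y R y"
  shows "multiplier_form l (X + X') = multiplier_form l X + multiplier_form l X'"
proof -
  have "l a (dPhi a (X + X')) = l a (dPhi a X) + l a (dPhi a X')" if a: "a \<in> R" for a
  proof -
    have "l a \<in> dual_space (lie_algebra M G)" using l a by auto
    then show ?thesis
      using linear_add[OF linear_dPhi[OF a], of X X']
        dual_space_simps(1)[of "l a"] dPhi_in_lie_algebra[OF a X] dPhi_in_lie_algebra[OF a X'] by simp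
  qed
  moreover have "dL a (X + X') = dL a X + dL a X'" if "a \<in> R" for a
    using linear_add[OF linear_dL[OF that]] .
  ultimately show ?thesis
    by (simp add: multiplier_form_def sum.distrib)
qed

text \<open>A face without the vertex \<open>v\<close> sees the zero variation, and multipliers
  vanish at zero.\<close>

lemma multiplier_form_single:
  assumes l: "l \<in> R \<rightarrow>\<^sub>E dual_space (lie_algebra M G)"
    and v: "v \<in> interior_verts n C R"
  shows "multiplier_form l (single v \<xi>) =
    (\<Sum>a\<in>star n C v. dL a (single v \<xi>)) + (\<Sum>a\<in>star n C v. l a (dPhi a (single v \<xi>)))"
proof -
  have "dL a (single v \<xi>) = 0" "l a (dPhi a (single v \<xi>)) = 0" if a: "a \<in> R - star n C v" for a
  proof -
    have aR: "a \<in> R" and "v \<notin> verts C a" using a star_interior[OF v] by auto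
    then have 0: "j1t C (single v \<xi>) a = j1t C 0 a"
      using j1t_single(2) linear_0[OF linear_j1t] by metis
    show "dL a (single v \<xi>) = 0"
      using linear_0[OF linear_dL[OF aR]] by (simp only: dL_def 0)
    have "dPhi a (single v \<xi>) = 0"
      using linear_0[OF linear_dPhi[OF aR]] by (simp only: dPhi_def 0)
    then show "l a (dPhi a (single v \<xi>)) = 0"
      using l aR dual_space_zero[OF _ subspace_lie_algebra, of "l a"] by auto
  qed
  moreover have "star n C v \<subseteq> R" using star_interior[OF v] by auto
  ultimately show ?thesis
    unfolding multiplier_form_def using finite_R
    by (intro arg_cong2[where f = "(+)"] sum.mono_neutral_right) auto
qed

lemma multiplier_form_eq_0_iff:
  assumes l: "l \<in> R \<rightarrow>\<^sub>E dual_space (lie_algebra M G)"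
  shows "(\<forall>X\<in>W. multiplier_form l X = 0) \<longleftrightarrow>
    (\<forall>v\<in>interior_verts n C R. \<forall>\<xi>\<in>tangent_space (Y v) (y v). multiplier_form l (single v \<xi>) = 0)"
proof
  assume "\<forall>X\<in>W. multiplier_form l X = 0"
  then show "\<forall>v\<in>interior_verts n C R. \<forall>\<xi>\<in>tangent_space (Y v) (y v). multiplier_form l (single v \<xi>) = 0"
    using single_variation by blast
next
  assume *: "\<forall>v\<in>interior_verts n C R. \<forall>\<xi>\<in>tangent_space (Y v) (y v). multiplier_form l (single v \<xi>) = 0"
  show "\<forall>X\<in>W. multiplier_form l X = 0"
  proof
    fix X assume X: "X \<in> W"
    have tangent: "X v \<in> tangent_space (Y v) (y v)" if "v \<in> interior_verts n C R" for v
      using X that by (simp add: fixed_boundary_variations_def variations_def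
          prod_tangent_space_def interior_verts_def)
    have fin: "finite (interior_verts n C R)"
      using finite_region_verts by (simp add: interior_verts_def)
    \<comment> \<open>Membership of the partial sums is carried along because additivity is
      available among variations only.\<close>
    have sums: "multiplier_form l (\<Sum>v\<in>J. single v (X v)) = 0 \<and> (\<Sum>v\<in>J. single v (X v)) \<in> variations C Y R y"
      if "finite J" "J \<subseteq> interior_verts n C R" for J
      using that
    proof (induction J)
      case empty
      have "multiplier_form l 0 = multiplier_form l 0 + multiplier_form l 0"
        using multiplier_form_add[OF l subspace_0 subspace_0] subspace_variations by simp
      then show ?case
        using subspace_0[OF subspace_variations] by (simp add: zero_fun_def)
    next
      case (insert v J)
      then have v: "single v (X v) \<in> variations C Y R y" "multiplier_form l (single v (X v)) = 0"
        using * tangent single_variation W_variations by auto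
      from insert have J: "multiplier_form l (\<Sum>v\<in>J. single v (X v)) = 0"
        "(\<Sum>v\<in>J. single v (X v)) \<in> variations C Y R y" by auto
      show ?case
        unfolding sum.insert[OF insert.hyps]
        using multiplier_form_add[OF l v(1) J(2)] subspace_add[OF subspace_variations v(1) J(2)] v(2) J(1)
        by (simp only: add_0)
    qed
    have apply_sum: "(\<Sum>v\<in>J. single v (X v)) w = (if w \<in> J then X w else 0)" if "finite J" for J w
      using that
    proof (induction J)
      case (insert v J)
      then show ?case
        by (simp only: sum.insert[OF insert.hyps] plus_fun_apply) (auto simp: single_def)
    qed simp
    \<comment> \<open>Off the region by the zero convention for families, on the frontier by the
      boundary condition.\<close>
    have "X w = 0" if "w \<notin> interior_verts n C R" for w
      using X that unfolding fixed_boundary_variations_def variations_def prod_tangent_space_def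
        frontier_verts_def by blast
    then have "(\<Sum>v\<in>interior_verts n C R. single v (X v)) = X"
      using apply_sum[OF fin] by (intro ext) simp
    then show "multiplier_form l X = 0"
      using sums[OF fin subset_refl] by simp
  qed
qed

text \<open>At an interior vertex \<open>v\<close> the form on the second jet space involves only
  the component \<open>X v\<close> of its argument, and equals \<open>multiplier_form\<close> along
  the variation supported at \<open>v\<close>.\<close>

lemma multiplier_equations_iff:
  assumes l: "l \<in> R \<rightarrow>\<^sub>E dual_space (lie_algebra M G)"
  shows "multiplier_equations n C Y M G \<Phi> L R y l \<longleftrightarrow> (\<forall>X\<in>W. multiplier_form l X = 0)"
proof -
  have eq: "euler_lagrange_form n C Y L v (j2 n C y v) X
      + (\<Sum>a\<in>star n C v. proj_pullback C a (\<lambda>z X. l a (cartan_Phi C Y M G \<Phi> a v z X)) (j2 n C y v) X)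
      = multiplier_form l (single v (X v))"
    if v: "v \<in> interior_verts n C R" and X: "X v \<in> tangent_space (Y v) (y v)" for v X
  proof -
    have a: "restrict (j2 n C y v) (verts C a) = j1 C y a"
      "(\<lambda>_. 0)(v := zrestrict X (verts C a) v) = j1t C (single v (X v)) a" "a \<in> R"
      if "a \<in> star n C v" for a
    proof -
      show "restrict (j2 n C y v) (verts C a) = j1 C y a"
        using that by (auto simp: j2_def j1_def star_verts_def verts_def star_def restrict_def fun_eq_iff)
      show "a \<in> R" using that star_interior[OF v] by simp
      have "v \<in> verts C a" using that star_interior[OF v] by simp
      then show "(\<lambda>_. 0)(v := zrestrict X (verts C a) v) = j1t C (single v (X v)) a"
        by (simp add: j1t_single(1)) (simp add: single_def zrestrict_def)
    qed
    have "euler_lagrange_form n C Y L v (j2 n C y v) X = (\<Sum>a\<in>star n C v. dL a (single v (X v)))"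
      unfolding euler_lagrange_form_def proj_pullback_def cartan_L_def form_component_def dL_def
      by (intro sum.cong refl) (simp only: a)
    moreover have "(\<Sum>a\<in>star n C v. proj_pullback C a (\<lambda>z X. l a (cartan_Phi C Y M G \<Phi> a v z X)) (j2 n C y v) X)
        = (\<Sum>a\<in>star n C v. l a (dPhi a (single v (X v))))"
      unfolding proj_pullback_def cartan_Phi_def form_component_def
      using theta_dPhi_eq[OF _ W_variations[OF single_variation[OF v X]]]
      by (intro sum.cong refl) (simp only: a)
    ultimately show ?thesis
      by (simp only: multiplier_form_single[OF l v])
  qed
  \<comment> \<open>An interior vertex lies in the region, hence on some face of it; its star is
    nonempty and \<open>v\<close> is one of the vertices of the second jet.\<close>
  have v_star: "v \<in> star_verts n C v" if "v \<in> interior_verts n C R" for v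
    using that faces by (auto simp: interior_verts_def region_verts_def star_verts_def star_def)
  have j2v: "j2 n C y v v = y v" if "v \<in> interior_verts n C R" for v
    using v_star[OF that] by (simp add: j2_def)
  have "(\<forall>X\<in>prod_tangent_space (star_verts n C v) Y (j2 n C y v). multiplier_form l (single v (X v)) = 0)
      \<longleftrightarrow> (\<forall>\<xi>\<in>tangent_space (Y v) (y v). multiplier_form l (single v \<xi>) = 0)"
    if v: "v \<in> interior_verts n C R" for v
  proof (intro iffI ballI)
    fix X assume "\<forall>\<xi>\<in>tangent_space (Y v) (y v). multiplier_form l (single v \<xi>) = 0"
      and "X \<in> prod_tangent_space (star_verts n C v) Y (j2 n C y v)"
    then show "multiplier_form l (single v (X v)) = 0"
      using v_star[OF v] j2v[OF v] by (auto simp: prod_tangent_space_def)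
  next
    fix \<xi> assume *: "\<forall>X\<in>prod_tangent_space (star_verts n C v) Y (j2 n C y v). multiplier_form l (single v (X v)) = 0"
      and \<xi>: "\<xi> \<in> tangent_space (Y v) (y v)"
    \<comment> \<open>Any \<open>\<xi>\<close> at \<open>v\<close> extends by zero to a tangent
      family over \<open>star_verts n C v\<close>, so passing from \<open>X\<close> to
      \<open>X v\<close> loses no test vector.\<close>
    have "0 \<in> tangent_space (Y w) p" if "w \<in> star_verts n C v" for w p
      using fibers that by (intro subspace_0 tangent_space_subspace) (auto simp: star_verts_def)
    then have "single v \<xi> \<in> prod_tangent_space (star_verts n C v) Y (j2 n C y v)"
      using \<xi> v_star[OF v] j2v[OF v] by (auto simp: prod_tangent_space_def single_def)
    then have "multiplier_form l (single v (single v \<xi> v)) = 0"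
      using * by blast
    then show "multiplier_form l (single v \<xi>) = 0"
      by (simp add: single_def)
  qed
  moreover have "X v \<in> tangent_space (Y v) (y v)"
    if "v \<in> interior_verts n C R" "X \<in> prod_tangent_space (star_verts n C v) Y (j2 n C y v)" for v X
    using that v_star[OF that(1)] j2v[OF that(1)] by (auto simp: prod_tangent_space_def)
  ultimately show ?thesis
    unfolding multiplier_equations_def multiplier_form_eq_0_iff[OF l]
    by (intro ball_cong refl) (simp only: eq cong: ball_cong)
qed

lemma linear_sum_dL: "linear (\<lambda>X. \<Sum>a\<in>R. dL a X)"
  by (intro linear_compose_sum ballI linear_dL)

lemma critical_iff_multiplier:
  "critical_fixed_boundary n C Y M G \<Phi> L R y \<longleftrightarrow>
    (\<exists>l \<in> R \<rightarrow>\<^sub>E dual_space (lie_algebra M G). multiplier_equations n C Y M G \<Phi> L R y l)"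
  using lagrange_multiplier_iff[OF subspace_W subspace_lie_algebra finite_R linear_dPhi linear_sum_dL dPhi_onto]
  by (simp only: critical_iff multiplier_equations_iff multiplier_form_def cong: bex_cong)

lemma multiplier_unique:
  assumes "l \<in> R \<rightarrow>\<^sub>E dual_space (lie_algebra M G)" "l' \<in> R \<rightarrow>\<^sub>E dual_space (lie_algebra M G)"
    and "multiplier_equations n C Y M G \<Phi> L R y l" "multiplier_equations n C Y M G \<Phi> L R y l'"
  shows "l = l'"
  using lagrange_multiplier_unique[OF subspace_W subspace_lie_algebra finite_R linear_dPhi linear_sum_dL dPhi_onto
      assms(1,2)] assms
  by (simp only: multiplier_equations_iff multiplier_form_def)

end

theorem theorem2p6:
  fixes C :: "'x cell_complex"
    and n m :: nat
    and Y :: "'x \<Rightarrow> ('a, 'c, 'i) mfd"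
    and M :: "('g, 'd, 'k) mfd"
    and G :: "'g monoid"
    and \<Phi> :: "'x \<Rightarrow> ('x \<Rightarrow> 'a) \<Rightarrow> 'g"
    and L :: "'x \<Rightarrow> ('x \<Rightarrow> 'a) \<Rightarrow> real"
    and \<V> :: "'x set"
    and y\<^sub>0 y :: "'x \<Rightarrow> 'a"
  assumes "cellular_complex n C"
    and "\<forall>\<alpha>\<in>cells C n. finite (verts C \<alpha>)"
    and "\<forall>v\<in>cells C 0. smooth_manifold (Y v) \<and> card (midx (Y v)) = m"
    and "lie_group M G"
    and "\<forall>\<alpha>\<in>cells C n. smooth_map (J1 C Y \<alpha>) real_line (L \<alpha>)"
    and "\<forall>\<alpha>\<in>cells C n. differentiable_map (J1 C Y \<alpha>) M (\<Phi> \<alpha>) \<and>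
                        regular_value (J1 C Y \<alpha>) M (\<Phi> \<alpha>) \<one>\<^bsub>G\<^esub>"
    and "finite \<V>" and "\<V> \<subseteq> cells C n"
    and "y\<^sub>0 \<in> sections C Y \<V>"
    and "y \<in> admissible_sections C Y G \<Phi> \<V>"
    and "\<forall>v\<in>frontier_verts n C \<V>. y v = y\<^sub>0 v"
    and "regular_section n C Y M G \<Phi> \<V> y"
  shows "(critical_fixed_boundary n C Y M G \<Phi> L \<V> y \<longleftrightarrow>
            (\<exists>l \<in> \<V> \<rightarrow>\<^sub>E dual_space (lie_algebra M G). multiplier_equations n C Y M G \<Phi> L \<V> y l))
       \<and> (\<forall>l \<in> \<V> \<rightarrow>\<^sub>E dual_space (lie_algebra M G). \<forall>l' \<in> \<V> \<rightarrow>\<^sub>E dual_space (lie_algebra M G).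
            multiplier_equations n C Y M G \<Phi> L \<V> y l \<and> multiplier_equations n C Y M G \<Phi> L \<V> y l'
            \<longrightarrow> l = l')"
proof -
  interpret regular_lagrange_problem C n Y M G \<Phi> L \<V> y
    using assms by unfold_locales (auto intro: smooth_map_imp_differentiable_map)
  show ?thesis
    using critical_iff_multiplier multiplier_unique by blast
qed

end
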